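(* For every $B\in\mathcal{H}_n^{\mathrm{nd}}(\mathfrak{o})$ we have $|\mathrm{GK}(B)|=\Delta(B)$.
   Context: $F$ is a non-archimedean local field of characteristic $0$ with ring of integers $\mathfrak{o}$, maximal ideal $\mathfrak{p}$ and a fixed prime element $\varpi$; $\mathrm{ord}$ is the normalized valuation ($\mathrm{ord}(\varpi)=1$, $\mathrm{ord}(0)=+\infty$). A symmetric matrix $B=(b_{ij})\in M_n(F)$ is half-integral if $b_{ii}\in\mathfrak{o}$ and $2b_{ij}\in\mathfrak{o}$ for all $i,j$; $\mathcal{H}_n(\mathfrak{o})$ is the set of these and $\mathcal{H}_n^{\mathrm{nd}}(\mathfrak{o})$ the subset with $\det B\neq 0$. For $X$ write $B[X]={}^tXBX$. For $\underline a=(a_1,\dots,a_n)\in\mathbb{Z}_{\ge0}^n$ put $|\underline a|=a_1+\cdots+a_n$ and let $\mathcal{M}(\underline a)$ be the set of $B=(b_{ij})\in\mathcal{H}_n(\mathfrak{o})$ with $\mathrm{ord}(b_{ii})\ge a_i$ for all $i$ and $\mathrm{ord}(2b_{ij})\ge (a_i+a_j)/2$ for $i<j$. For $B\in\mathcal{H}_n^{\mathrm{nd}}(\mathfrak{o})$, $S(B)$ is the set of non-decreasing $\underline a\in\mathbb{Z}_{\ge0}^n$ with $B\in\mathcal{M}(\underline a)$, and the Gross–Keating invariant $\mathrm{GK}(B)$ is the greatest element, for the lexicographic order (at the first index where two sequences differ, the one with the larger entry is larger), of the finite set $\bigcup_{U\in \mathrm{GL}_n(\mathfrak{o})}S(B[U])$.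 For $B\in\mathcal{H}_n^{\mathrm{nd}}(\mathfrak{o})$ put $D_B=(-4)^{[n/2]}\det B$. If $n$ is even, let $\mathfrak{D}_B$ be the discriminant ideal of $F(\sqrt{D_B})/F$ (equal to $\mathfrak{o}$ if $D_B\in F^{\times2}$), and let $\xi_B=1$ if $D_B\in F^{\times 2}$, $\xi_B=-1$ if $F(\sqrt{D_B})/F$ is an unramified quadratic extension, and $\xi_B=0$ if it is ramified. Define $\Delta(B)=\mathrm{ord}(D_B)$ if $n$ is odd, and $\Delta(B)=\mathrm{ord}(D_B)-\mathrm{ord}(\mathfrak{D}_B)+1-\xi_B^2$ if $n$ is even. *)

theory Defs
  imports
    "HOL-Library.Extended_Real"
    "HOL-Library.List_Lexorder"
    "HOL-Algebra.Algebraic_Closure_Type"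
    "Jordan_Normal_Form.Determinant"
begin

section \<open>Non-archimedean local fields of characteristic zero\<close>

text \<open>
  A local field is taken as a field that is complete for a normalized discrete valuation
  and has a finite residue field. Characteristic zero is the class constraint. The
  valuation is \<open>ereal\<close>-valued so that the value at zero is infinite; all
  other values are integers.
\<close>

definition val_ring :: "('a::field \<Rightarrow> ereal) \<Rightarrow> 'a set" where
  "val_ring ord = {x. 0 \<le> ord x}"

definition val_ideal :: "('a::field \<Rightarrow> ereal) \<Rightarrow> 'a set" where
  "val_ideal ord = {x. 0 < ord x}"

locale nonarch_local_field =
  fixes ord :: "'a::field_char_0 \<Rightarrow> ereal" and \<pi> :: 'a
  assumes ord_eq_infinity_iff: "ord x = \<infinity> \<longleftrightarrow> x = 0"
    and ord_integral: "x \<noteq> 0 \<Longrightarrow> \<exists>k::int. ord x = ereal (of_int k)"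
    and ord_mult: "ord (x * y) = ord x + ord y"
    and ord_add: "min (ord x) (ord y) \<le> ord (x + y)"
    and ord_prime_element: "ord \<pi> = 1"
    and complete:
      "\<And>f :: nat \<Rightarrow> 'a. (\<And>k::nat. \<exists>N. \<forall>i\<ge>N. \<forall>j\<ge>N. ereal k \<le> ord (f i - f j)) \<Longrightarrow>
       \<exists>l. \<forall>k::nat. \<exists>N. \<forall>i\<ge>N. ereal k \<le> ord (f i - l)"
    and finite_residue_field:
      "finite (val_ring ord //
         {(x, y). x \<in> val_ring ord \<and> y \<in> val_ring ord \<and> x - y \<in> val_ideal ord})"

section \<open>Half-integral matrices and the Gross-Keating invariant\<close>

text \<open>Matrix and sequence indices run over \<open>0, \<dots>, n - 1\<close>.\<close>

definition half_integral :: "('a::field_char_0 \<Rightarrow> ereal) \<Rightarrow> nat \<Rightarrow> 'a mat set" where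
  "half_integral ord n = {B \<in> carrier_mat n n. transpose_mat B = B \<and>
     (\<forall>i<n. B $$ (i, i) \<in> val_ring ord) \<and>
     (\<forall>i<n. \<forall>j<n. 2 * B $$ (i, j) \<in> val_ring ord)}"

definition half_integral_nd :: "('a::field_char_0 \<Rightarrow> ereal) \<Rightarrow> nat \<Rightarrow> 'a mat set" where
  "half_integral_nd ord n = {B \<in> half_integral ord n. det B \<noteq> 0}"

definition int_mat :: "('a::field_char_0 \<Rightarrow> ereal) \<Rightarrow> nat \<Rightarrow> 'a mat set" where
  "int_mat ord n = {U \<in> carrier_mat n n. \<forall>i<n. \<forall>j<n. U $$ (i, j) \<in> val_ring ord}"

definition GL_int :: "('a::field_char_0 \<Rightarrow> ereal) \<Rightarrow> nat \<Rightarrow> 'a mat set" where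
  "GL_int ord n =
     {U \<in> int_mat ord n. \<exists>V \<in> int_mat ord n. inverts_mat U V \<and> inverts_mat V U}"

definition mat_transform :: "'a::field_char_0 mat \<Rightarrow> 'a mat \<Rightarrow> 'a mat" where
  "mat_transform B Y = transpose_mat Y * B * Y"

definition M_set :: "('a::field_char_0 \<Rightarrow> ereal) \<Rightarrow> nat \<Rightarrow> nat list \<Rightarrow> 'a mat set" where
  "M_set ord n a = {B \<in> half_integral ord n.
     (\<forall>i<n. ereal (a ! i) \<le> ord (B $$ (i, i))) \<and>
     (\<forall>i j. i < j \<and> j < n \<longrightarrow> ereal ((a ! i + a ! j) / 2) \<le> ord (2 * B $$ (i, j)))}"

definition S_set :: "('a::field_char_0 \<Rightarrow> ereal) \<Rightarrow> nat \<Rightarrow> 'a mat \<Rightarrow> nat list set" where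
  "S_set ord n B = {a. length a = n \<and> sorted a \<and> B \<in> M_set ord n a}"

text \<open>
  The order on \<open>nat list\<close> is the one of \<open>List_Lexorder\<close>; on lists of equal length
  it is the lexicographic order decided at the first differing entry.
\<close>

definition GK :: "('a::field_char_0 \<Rightarrow> ereal) \<Rightarrow> nat \<Rightarrow> 'a mat \<Rightarrow> nat list" where
  "GK ord n B = (GREATEST a. a \<in> (\<Union>U \<in> GL_int ord n. S_set ord n (mat_transform B U)))"

section \<open>The extension obtained by adjoining a square root\<close>

definition nonzero_square :: "'a::field \<Rightarrow> bool" where
  "nonzero_square D \<longleftrightarrow> (\<exists>y. y \<noteq> 0 \<and> D = y ^ 2)"

text \<open>
  The field \<open>F(\<surd>D)\<close> is realized inside the algebraic closure of \<open>F\<close>. It does not depend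
  on which of the two square roots is chosen.
\<close>

definition sqrt_ac :: "'a::field_char_0 \<Rightarrow> 'a alg_closure" where
  "sqrt_ac D = (SOME s. s ^ 2 = to_ac D)"

definition quad_ext :: "'a::field_char_0 \<Rightarrow> 'a alg_closure set" where
  "quad_ext D = {to_ac a + to_ac b * sqrt_ac D | a b. True}"

text \<open>The ring of integers is the integral closure of \<open>val_ring ord\<close> in \<open>F(\<surd>D)\<close>.\<close>

definition quad_int :: "('a::field_char_0 \<Rightarrow> ereal) \<Rightarrow> 'a \<Rightarrow> 'a alg_closure set" where
  "quad_int ord D = {x \<in> quad_ext D. \<exists>p :: 'a poly.
     Polynomial.lead_coeff p = 1 \<and> (\<forall>i. Polynomial.coeff p i \<in> val_ring ord) \<and>
     poly (map_poly to_ac p) x = 0}"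

text \<open>
  For \<open>D\<close> not a square, the trace of \<open>x\<close> is the trace \<open>a + d\<close> of the matrix of
  multiplication by \<open>x\<close> in the basis \<open>1, \<surd>D\<close> of \<open>F(\<surd>D)\<close> over \<open>F\<close>.
\<close>

definition quad_trace :: "'a::field_char_0 \<Rightarrow> 'a alg_closure \<Rightarrow> 'a" where
  "quad_trace D x = (THE t. \<exists>a b c d.
     x * 1 = to_ac a * 1 + to_ac c * sqrt_ac D \<and>
     x * sqrt_ac D = to_ac b * 1 + to_ac d * sqrt_ac D \<and> t = a + d)"

definition quad_disc :: "'a::field_char_0 \<Rightarrow> 'a alg_closure \<Rightarrow> 'a alg_closure \<Rightarrow> 'a" where
  "quad_disc D x y = quad_trace D (x * x) * quad_trace D (y * y) -
     quad_trace D (x * y) * quad_trace D (y * x)"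

definition val_ring_ideal :: "('a::field_char_0 \<Rightarrow> ereal) \<Rightarrow> 'a set \<Rightarrow> bool" where
  "val_ring_ideal ord I \<longleftrightarrow> I \<subseteq> val_ring ord \<and> 0 \<in> I \<and>
     (\<forall>x\<in>I. \<forall>y\<in>I. x + y \<in> I) \<and> (\<forall>c\<in>val_ring ord. \<forall>x\<in>I. c * x \<in> I)"

text \<open>
  The discriminant ideal is generated by the discriminants of the bases of \<open>F(\<surd>D)\<close> over
  \<open>F\<close> that consist of integers. Linearly dependent pairs are harmless, since their
  discriminant is zero.
\<close>

definition disc_ideal :: "('a::field_char_0 \<Rightarrow> ereal) \<Rightarrow> 'a \<Rightarrow> 'a set" where
  "disc_ideal ord D =
     (if nonzero_square D then val_ring ord
      else val_ring_ideal ord hull {quad_disc D x y | x y. x \<in> quad_int ord D \<and> y \<in> quad_int ord D})"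

text \<open>The set on the right-hand side is the \<open>k\<close>-th power of the maximal ideal.\<close>

definition ord_ideal :: "('a::field_char_0 \<Rightarrow> ereal) \<Rightarrow> 'a set \<Rightarrow> nat" where
  "ord_ideal ord I = (THE k::nat. I = {x. ereal k \<le> ord x})"

text \<open>
  For \<open>D\<close> not a square, \<open>F(\<surd>D)\<close> is unramified over \<open>F\<close> iff the maximal ideal of \<open>F\<close>
  generates the maximal ideal (the set of non-units) of the ring of integers of \<open>F(\<surd>D)\<close>;
  separability of the residue field extension is automatic for finite residue fields.
  As the maximal ideal of \<open>F\<close> is principal, the ideal it generates consists of products.
\<close>

definition unramified_quad :: "('a::field_char_0 \<Rightarrow> ereal) \<Rightarrow> 'a \<Rightarrow> bool" where
  "unramified_quad ord D \<longleftrightarrow> \<not> nonzero_square D \<and>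
     {x \<in> quad_int ord D. \<not> (\<exists>y \<in> quad_int ord D. x * y = 1)} =
     {to_ac c * y | c y. c \<in> val_ideal ord \<and> y \<in> quad_int ord D}"

section \<open>The invariant \<open>\<Delta>\<close>\<close>

definition D_inv :: "nat \<Rightarrow> 'a::field_char_0 mat \<Rightarrow> 'a" where
  "D_inv n B = (-4) ^ (n div 2) * det B"

definition xi_inv :: "('a::field_char_0 \<Rightarrow> ereal) \<Rightarrow> nat \<Rightarrow> 'a mat \<Rightarrow> int" where
  "xi_inv ord n B =
     (if nonzero_square (D_inv n B) then 1
      else if unramified_quad ord (D_inv n B) then -1 else 0)"

definition Delta_inv :: "('a::field_char_0 \<Rightarrow> ereal) \<Rightarrow> nat \<Rightarrow> 'a mat \<Rightarrow> ereal" where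
  "Delta_inv ord n B =
     (if odd n then ord (D_inv n B)
      else ord (D_inv n B) - ereal (ord_ideal ord (disc_ideal ord (D_inv n B)))
           + 1 - ereal (of_int ((xi_inv ord n B) ^ 2)))"

end

theory Submission
  imports Defs
begin

text \<open>
  A norm \<open>\<nu>(x) = min (ord x\<^sub>i + a\<^sub>i / 2)\<close> on \<open>F\<^sup>n\<close> turns the condition \<open>B \<in> \<M>(a)\<close> into the bound
  \<open>ord B[x] \<ge> 2 \<nu>(x)\<close>. Suppose that some vector is defective: nonzero on the graded piece of degree
  \<open>\<nu>(x)\<close>, in the radical of the polar form there, and annihilated by the quadratic form. Then it can
  replace the last basis vector on which it is supported, and this raises one entry of \<open>a\<close>. So a
  lexicographically maximal \<open>a\<close> admits no defective vector.

  Without defective vectors, one splits off binary blocks by Schur complements (and unary ones in odd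
  residue characteristic). In residue characteristic \<open>2\<close> the perfectness of the residue field leaves a
  remainder of rank at most \<open>2\<close>, with weights of different parity if the rank is \<open>2\<close>. The
  blocks show that \<open>D\<^sub>B\<close> has valuation \<open>|a|\<close> for odd \<open>n\<close>, and that for even \<open>n\<close> it is
  \<open>y\<^sup>2 (s\<^sup>2 - 4 w)\<close> where \<open>X\<^sup>2 - s X + w\<close> either has unit discriminant, with \<open>2 ord y = |a|\<close>, or is
  Eisenstein, with \<open>2 ord y + 1 = |a|\<close>. In both cases a root of the polynomial generates the ring of
  integers of \<open>F(\<surd>D\<^sub>B)\<close>, which yields the discriminant and \<open>\<xi>\<close>.
\<close>

section \<open>Valuations\<close>

text \<open>The obstacle is residue characteristic 2: forms need not be diagonalizable over the
  valuation ring, and halving lowers valuations. Quadratic form and polar form are therefore bounded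
  separately, with only the diagonal entries tested after division by 2.

  Parity enters because scaling a basis vector shifts its norm \<open>ord x + a / 2\<close> by an
  integer, so two weights share graded pieces exactly when they agree modulo 2. Where the polar form
  vanishes, the quadratic form on such a piece is a sum of terms \<open>c t\<^sup>2\<close>; two
  terms cancel as soon as every residue is a square, and this cancellation is a defect.

  Taking the last vector of the support is forced by sortedness: the earlier coordinates are then
  integral, so the replacement stays inside the integral group.

  A binary block with tight off-diagonal entry \<open>t\<close> has determinant
  \<open>- t\<^sup>2 (1 - 4 v)\<close>. Its factor \<open>1 - 4 v\<close> is itself a discriminant,
  that of \<open>X\<^sup>2 - X + v\<close>, and multiplying \<open>s\<^sup>2 - 4 w\<close> by it
  changes only \<open>w\<close>. This is why the alternative between unit discriminant and
  Eisenstein survives the induction on the rank.\<close>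

lemma one_le_imp_zero_le_ereal: "(1::ereal) \<le> x \<Longrightarrow> 0 \<le> x"
  by (rule order_trans[of _ 1]) auto

lemma ereal_le_weaken: "ereal r \<le> z \<Longrightarrow> s \<le> r \<Longrightarrow> ereal s \<le> z"
  by (rule order_trans) auto

lemma ereal_less_weaken: "ereal r < z \<Longrightarrow> s \<le> r \<Longrightarrow> ereal s < z"
  by (rule le_less_trans) auto

context nonarch_local_field
begin

lemma ord_0 [simp]: "ord 0 = \<infinity>"
  using ord_eq_infinity_iff by blast

lemma ord_nonzeroE:
  assumes "x \<noteq> 0"
  obtains k :: int where "ord x = ereal (of_int k)"
  using ord_integral[OF assms] by blast

lemma ord_neq_minf [simp]: "ord x \<noteq> -\<infinity>"
  using ord_integral[of x] ord_0 by (cases "x = 0") auto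

lemma ord_1 [simp]: "ord 1 = 0"
proof -
  obtain k :: int where k: "ord 1 = ereal (of_int k)"
    using ord_nonzeroE[of 1] by auto
  have "ord (1 * 1) = ord 1 + ord 1" by (rule ord_mult)
  then show ?thesis using k by (simp add: zero_ereal_def)
qed

lemma ord_minus_1: "ord (-1) = 0"
proof -
  obtain k :: int where k: "ord (-1) = ereal (of_int k)"
    using ord_nonzeroE[of "-1"] by auto
  have "ord ((-1) * (-1)) = ord (-1) + ord (-1)" by (rule ord_mult)
  then show ?thesis using k by (simp add: zero_ereal_def)
qed

lemma ord_minus [simp]: "ord (- x) = ord x"
  using ord_mult[of "-1" x] ord_minus_1 by simp

lemma ord_minus_commute: "ord (x - y) = ord (y - x)"
  using ord_minus[of "x - y"] by simp

lemma ord_add_ge: "r \<le> ord x \<Longrightarrow> r \<le> ord y \<Longrightarrow> r \<le> ord (x + y)"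
  using ord_add[of x y] by (meson min.boundedI order_trans)

lemma ord_add_gt: "r < ord x \<Longrightarrow> r < ord y \<Longrightarrow> r < ord (x + y)"
  using ord_add[of x y] by (meson min_less_iff_conj less_le_trans)

lemma ord_diff_ge: "r \<le> ord x \<Longrightarrow> r \<le> ord y \<Longrightarrow> r \<le> ord (x - y)"
  using ord_add_ge[of r x "-y"] by simp

lemma ord_diff_gt: "r < ord x \<Longrightarrow> r < ord y \<Longrightarrow> r < ord (x - y)"
  using ord_add_gt[of r x "-y"] by simp

lemma ord_add_eq: "ord x < ord y \<Longrightarrow> ord (x + y) = ord x"
proof (rule antisym)
  assume less: "ord x < ord y"
  show "ord x \<le> ord (x + y)" using less by (intro ord_add_ge) auto
  show "ord (x + y) \<le> ord x"
  proof (rule ccontr)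
    assume "\<not> ord (x + y) \<le> ord x"
    then have "ord x < ord (x + y - y)" using less by (intro ord_diff_gt) auto
    then show False by simp
  qed
qed

lemma ord_add_eq2: "ord y < ord x \<Longrightarrow> ord (x + y) = ord y"
  using ord_add_eq[of y x] by (simp add: add.commute)

lemma ord_sum_ge: "(\<And>i. i \<in> A \<Longrightarrow> r \<le> ord (f i)) \<Longrightarrow> r \<le> ord (sum f A)"
  by (induction A rule: infinite_finite_induct) (auto intro: ord_add_ge)

lemma ord_sum_gt: "r < \<infinity> \<Longrightarrow> (\<And>i. i \<in> A \<Longrightarrow> r < ord (f i)) \<Longrightarrow> r < ord (sum f A)"
  by (induction A rule: infinite_finite_induct) (auto intro: ord_add_gt)

lemma ord_mult_ge: "ereal r \<le> ord x \<Longrightarrow> ereal s \<le> ord y \<Longrightarrow> ereal (r + s) \<le> ord (x * y)"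
  unfolding ord_mult plus_ereal.simps(1)[symmetric] by (rule add_mono)

lemma ord_mult_gt: "ereal r < ord x \<Longrightarrow> ereal s \<le> ord y \<Longrightarrow> ereal (r + s) < ord (x * y)"
  unfolding ord_mult by (cases "ord x"; cases "ord y") auto

lemma ord_mult_gt2: "ereal r \<le> ord x \<Longrightarrow> ereal s < ord y \<Longrightarrow> ereal (r + s) < ord (x * y)"
  unfolding ord_mult by (cases "ord x"; cases "ord y") auto

lemma ord_mult_ge0: "0 \<le> ord x \<Longrightarrow> 0 \<le> ord y \<Longrightarrow> 0 \<le> ord (x * y)"
  unfolding ord_mult by simp

lemma ord_prod: "ord (prod f A) = sum (\<lambda>i. ord (f i)) A"
  by (induction A rule: infinite_finite_induct) (auto simp: ord_mult)

lemma ord_power: "ord x = ereal r \<Longrightarrow> ord (x ^ n) = ereal (real n * r)"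
  by (induction n) (auto simp: ord_mult algebra_simps zero_ereal_def)

lemma ord_power2: "ord (x\<^sup>2) = ord x + ord x"
  by (simp add: power2_eq_square ord_mult)

lemma ord_inverse: "ord x = ereal r \<Longrightarrow> ord (inverse x) = ereal (- r)"
proof -
  assume r: "ord x = ereal r"
  then have x: "x \<noteq> 0" by auto
  have "ord (x * inverse x) = ord x + ord (inverse x)" by (rule ord_mult)
  then show ?thesis using x r by (cases "ord (inverse x)") (auto simp: zero_ereal_def)
qed

lemma ord_divide: "ord y = ereal s \<Longrightarrow> ord (x / y) = ord x - ereal s"
  unfolding divide_inverse ord_mult by (simp add: ord_inverse minus_ereal_def)

lemma ord_gt_int: "ereal (of_int k) < ord x \<Longrightarrow> ereal (of_int k + 1) \<le> ord x"
  by (cases "x = 0") (auto elim!: ord_nonzeroE)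

lemma ord_gt_0: "0 < ord x \<Longrightarrow> 1 \<le> ord x"
  using ord_gt_int[of 0 x] by (simp add: zero_ereal_def one_ereal_def)

text \<open>Off-diagonal bounds are half-integers while valuations are integers, so a strict bound
  by \<open>k / 2\<close> improves by a half. This half is what raising one weight by 1 demands of
  an off-diagonal entry.\<close>

lemma ord_ge_half_int:
  assumes "ereal (of_int k / 2) < ord x"
  shows "ereal ((of_int k + 1) / 2) \<le> ord x"
proof (cases "x = 0")
  case False
  then obtain m :: int where m: "ord x = ereal (of_int m)" by (rule ord_nonzeroE)
  with assms have "real_of_int k < real_of_int (2 * m)" by simp
  then have "k + 1 \<le> 2 * m" by linarith
  then have "real_of_int (k + 1) \<le> real_of_int (2 * m)" by linarith
  then show ?thesis using m by simp
qed simp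

lemma pi_nonzero [simp]: "\<pi> \<noteq> 0"
  using ord_prime_element by auto

lemma ord_exists: "\<exists>c. c \<noteq> 0 \<and> ord c = ereal (of_int k)"
proof (cases "k \<ge> 0")
  case True
  then have "ord (\<pi> ^ nat k) = ereal (of_int k)"
    using ord_power[of \<pi> 1] ord_prime_element by (simp add: one_ereal_def)
  then show ?thesis by (intro exI[of _ "\<pi> ^ nat k"]) auto
next
  case False
  then have "ord (\<pi> ^ nat (-k)) = ereal (of_int (-k))"
    using ord_power[of \<pi> 1] ord_prime_element by (simp add: one_ereal_def)
  then have "ord (inverse (\<pi> ^ nat (-k))) = ereal (of_int k)"
    by (subst ord_inverse) auto
  then show ?thesis by (intro exI[of _ "inverse (\<pi> ^ nat (-k))"]) auto
qed

lemma ord_of_nat_ge: "0 \<le> ord (of_nat n)"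
  by (induction n) (auto intro: ord_add_ge)

lemma ord_numeral_ge [simp]: "0 \<le> ord (numeral n)"
  using ord_of_nat_ge[of "numeral n"] by simp

lemma ord_4: "ord 4 = ord 2 + ord 2"
  using ord_mult[of 2 2] by simp

section \<open>Integral roots and Hensel lifting for quadratic polynomials\<close>

lemma ord_integral_poly_root:
  assumes "x\<^sup>2 + u * x + c = 0" "0 \<le> ord u" "0 \<le> ord c"
  shows "0 \<le> ord x"
proof (rule ccontr)
  assume "\<not> 0 \<le> ord x"
  moreover have "x \<noteq> 0" using calculation by auto
  ultimately obtain k :: int where k: "ord x = ereal (of_int k)" "k < 0"
    by (auto elim!: ord_nonzeroE)
  have "ord (x\<^sup>2) < ord (u * x)"
    using assms(2) k by (cases "ord u") (auto simp: ord_power2 ord_mult)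
  then have "ord (x\<^sup>2 + u * x) = ord (x\<^sup>2)" by (rule ord_add_eq)
  also have "\<dots> < ord c" using k assms(3) by (cases "ord c") (auto simp: ord_power2)
  finally have "ord (x\<^sup>2 + u * x + c) = ord (x\<^sup>2 + u * x)" by (rule ord_add_eq)
  with \<open>ord (x\<^sup>2 + u * x) = ord (x\<^sup>2)\<close> show False using k assms(1) by (simp add: ord_power2)
qed

text \<open>Newton iteration with the derivative frozen at the approximate root.\<close>

lemma hensel_quadratic_0:
  assumes u: "ord u = 0" and c: "0 < ord c"
  shows "\<exists>h. h\<^sup>2 + u * h + c = 0"
proof -
  have u0: "u \<noteq> 0" using u by auto
  define h where "h = rec_nat 0 (\<lambda>_ x. - (c + x\<^sup>2) / u)"
  have h0: "h 0 = 0" and hS: "h (Suc k) = - (c + (h k)\<^sup>2) / u" for k by (auto simp: h_def)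
  have div: "ord (x / u) = ord x" for x using ord_divide[of u 0 x] u by (simp add: zero_ereal_def)
  have c1: "1 \<le> ord c" using c by (rule ord_gt_0)
  have h1: "1 \<le> ord (h k)" for k
  proof (induction k)
    case (Suc k)
    have "1 \<le> ord (h k * h k)"
      using ord_mult_ge[of 1 "h k" 0 "h k"] Suc order_trans[of "ereal 0" "ereal 1"]
      by (simp add: one_ereal_def)
    then have "1 \<le> ord (c + (h k)\<^sup>2)" using c1 by (intro ord_add_ge) (auto simp: power2_eq_square)
    then show ?case unfolding hS by (simp add: div del: minus_add_distrib)
  qed (simp add: h0)
  have step: "ereal (real k + 1) \<le> ord (h (Suc k) - h k)" for k
  proof (induction k)
    case 0
    then show ?case using h1[of 1] by (simp add: h0 one_ereal_def)
  next
    case (Suc k)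
    \<comment> \<open>The iteration contracts: the factor \<open>h (Suc k) + h k\<close> has
      positive valuation and \<open>u\<close> is a unit.\<close>
    have eq: "h (Suc (Suc k)) - h (Suc k) = - ((h (Suc k) - h k) * (h (Suc k) + h k)) / u"
    proof -
      have "- (c + x\<^sup>2) / u - - (c + y\<^sup>2) / u = - ((x - y) * (x + y)) / u" for x y
        using u0 by (simp add: field_simps power2_eq_square)
      from this[of "h (Suc k)" "h k"] show ?thesis by (simp only: hS[symmetric])
    qed
    have "ereal 1 \<le> ord (h (Suc k) + h k)" using h1[of k] h1[of "Suc k"] ord_add_ge by (auto simp: one_ereal_def)
    from ord_mult_ge[OF Suc.IH this] show ?case unfolding eq by (simp add: div add.commute)
  qed
  have cauchy: "ereal (real k) \<le> ord (h (k + m) - h k)" for k m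
  proof (induction m)
    case (Suc m)
    have "ereal (real k) \<le> ord (h (Suc (k + m)) - h (k + m))"
      by (rule order_trans[OF _ step]) simp
    from ord_add_ge[OF this Suc] show ?case by simp
  qed simp
  have cauchy': "ereal (real k) \<le> ord (h i - h j)" if "i \<ge> k" "j \<ge> k" for i j k
    using ord_diff_ge[OF cauchy[of k "i - k"] cauchy[of k "j - k"]] that by simp
  obtain l where l: "\<And>k::nat. \<exists>N. \<forall>i\<ge>N. ereal k \<le> ord (h i - l)"
    using complete[of h] cauchy' by blast
  have "ereal (real k) \<le> ord (l\<^sup>2 + u * l + c)" for k
  proof -
    obtain N where N: "\<And>i. i \<ge> N \<Longrightarrow> ereal k \<le> ord (h i - l)" using l by blast
    have l0: "0 \<le> ord l"
      using ord_diff_ge[of 0 "h N" "h N - l"] order_trans[OF _ N[of N], of 0]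
        order_trans[OF _ h1[of N], of 0] by simp
    define i where "i = N + k"
    have a: "ereal k \<le> ord (l - h i)" using N[of i] by (simp add: i_def ord_minus_commute)
    have b: "ereal 0 \<le> ord (l + h i + u)"
      using l0 h1[of i] u by (intro ord_add_ge) (auto simp flip: zero_ereal_def intro: order_trans[OF _ h1])
    have d: "ereal k \<le> ord (u * (h i - h (Suc i)))"
      using cauchy'[of k i "Suc i"] by (simp add: ord_mult u i_def)
    \<comment> \<open>The recursion gives \<open>c = - u * h (Suc i) - (h i)\<^sup>2\<close>. Both
      summands are small, since iterates are close to the limit and to each other.\<close>
    have "l\<^sup>2 + u * l + c = (l - h i) * (l + h i + u) + u * (h i - h (Suc i))"
      unfolding hS using u0 by (simp add: field_simps power2_eq_square)
    also have "ereal k \<le> ord \<dots>" using ord_mult_ge[OF a b] d by (intro ord_add_ge) auto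
    finally show ?thesis .
  qed
  then have "ord (l\<^sup>2 + u * l + c) = \<infinity>"
    by (intro ereal_top) (meson ereal_less_eq(3) less_imp_le order_trans reals_Archimedean2)
  then show ?thesis using ord_eq_infinity_iff by blast
qed

text \<open>Translation by the approximate root \<open>r\<close> turns the derivative
  \<open>2 * r - s\<close> into the linear coefficient.\<close>

lemma hensel_quadratic:
  assumes "0 < ord (r\<^sup>2 - s * r + w)" "ord (2 * r - s) = 0"
  shows "\<exists>x. x\<^sup>2 - s * x + w = 0"
proof -
  obtain h where "h\<^sup>2 + (2 * r - s) * h + (r\<^sup>2 - s * r + w) = 0"
    using hensel_quadratic_0[OF assms(2,1)] by blast
  then have "(r + h)\<^sup>2 - s * (r + h) + w = 0" by (simp add: algebra_simps power2_eq_square)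
  then show ?thesis by blast
qed

end

section \<open>Quadratic extensions\<close>

lemma sqrt_ac_square: "(sqrt_ac D)\<^sup>2 = to_ac D"
proof -
  have "\<exists>x. poly [:- to_ac D, 0, 1:] x = 0"
    by (rule alg_closed_imp_poly_has_root) simp
  then have "\<exists>s. s\<^sup>2 = to_ac D" by (auto simp: power2_eq_square algebra_simps)
  then show ?thesis unfolding sqrt_ac_def by (rule someI_ex)
qed

definition quad_elem :: "'a::field_char_0 \<Rightarrow> 'a \<Rightarrow> 'a \<Rightarrow> 'a alg_closure" where
  "quad_elem D a b = to_ac a + to_ac b * sqrt_ac D"

lemma quad_ext_iff: "x \<in> quad_ext D \<longleftrightarrow> (\<exists>a b. x = quad_elem D a b)"
  by (auto simp: quad_ext_def quad_elem_def)

lemma quad_elem_add: "quad_elem D a b + quad_elem D a' b' = quad_elem D (a + a') (b + b')"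
  by (simp add: quad_elem_def algebra_simps)

lemma quad_elem_mult:
  "quad_elem D a b * quad_elem D a' b' = quad_elem D (a * a' + b * b' * D) (a * b' + a' * b)"
proof -
  have "quad_elem D a b * quad_elem D a' b' =
      to_ac a * to_ac a' + to_ac b * to_ac b' * (sqrt_ac D)\<^sup>2
      + (to_ac a * to_ac b' + to_ac a' * to_ac b) * sqrt_ac D"
    by (simp add: quad_elem_def algebra_simps power2_eq_square)
  then show ?thesis by (simp add: sqrt_ac_square quad_elem_def)
qed

lemma quad_elem_to_ac: "quad_elem D a 0 = to_ac a"
  by (simp add: quad_elem_def)

lemma quad_elem_eq_iff:
  assumes "\<not> nonzero_square D" "D \<noteq> 0"
  shows "quad_elem D a b = quad_elem D a' b' \<longleftrightarrow> a = a' \<and> b = b'"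
proof
  assume eq: "quad_elem D a b = quad_elem D a' b'"
  show "a = a' \<and> b = b'"
  proof (cases "b = b'")
    case False
    have "to_ac (b' - b) * sqrt_ac D = to_ac (a - a')"
      using eq by (simp add: quad_elem_def algebra_simps)
    then have "sqrt_ac D = to_ac ((a - a') / (b' - b))"
      using False by (simp add: field_simps)
    then have "to_ac D = to_ac (((a - a') / (b' - b))\<^sup>2)"
      using sqrt_ac_square[of D] by simp
    then have "D = ((a - a') / (b' - b))\<^sup>2" by (simp only: to_ac_eq_iff)
    then show ?thesis using assms by (metis nonzero_square_def power_zero_numeral)
  qed (use eq in \<open>simp add: quad_elem_def\<close>)
qed auto

lemma quad_trace_quad_elem:
  assumes "\<not> nonzero_square D" "D \<noteq> 0"
  shows "quad_trace D (quad_elem D a b) = 2 * a"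
  unfolding quad_trace_def
proof (rule the_equality)
  have s: "sqrt_ac D = quad_elem D 0 1" by (simp add: quad_elem_def)
  have 1: "to_ac a' * 1 + to_ac c * sqrt_ac D = quad_elem D a' c" for a' c by (simp add: quad_elem_def)
  have 2: "quad_elem D a b * sqrt_ac D = quad_elem D (b * D) a"
    using quad_elem_mult[of D a b 0 1] s by simp
  show "\<exists>a' b' c d. quad_elem D a b * 1 = to_ac a' * 1 + to_ac c * sqrt_ac D \<and>
      quad_elem D a b * sqrt_ac D = to_ac b' * 1 + to_ac d * sqrt_ac D \<and> 2 * a = a' + d"
    unfolding 1 2 by (intro exI[of _ a] exI[of _ "b * D"] exI[of _ b] exI[of _ a]) auto
  fix t
  assume "\<exists>a' b' c d. quad_elem D a b * 1 = to_ac a' * 1 + to_ac c * sqrt_ac D \<and>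
      quad_elem D a b * sqrt_ac D = to_ac b' * 1 + to_ac d * sqrt_ac D \<and> t = a' + d"
  then show "t = 2 * a" unfolding 1 2 by (auto simp: quad_elem_eq_iff[OF assms])
qed

lemma quad_disc_quad_elem:
  assumes "\<not> nonzero_square D" "D \<noteq> 0"
  shows "quad_disc D (quad_elem D a b) (quad_elem D a' b') = 4 * D * (a * b' - a' * b)\<^sup>2"
  by (simp add: quad_disc_def quad_elem_mult quad_trace_quad_elem[OF assms] algebra_simps power2_eq_square)

lemma poly_map_to_ac_add:
  "poly (map_poly to_ac (p + q)) x = poly (map_poly to_ac p) x + poly (map_poly to_ac q) x"
proof -
  have "map_poly to_ac (p + q) = map_poly to_ac p + map_poly to_ac q"
    by (intro poly_eqI) (simp add: coeff_map_poly)
  then show ?thesis by simp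
qed

lemma poly_map_to_ac_mult:
  "poly (map_poly to_ac (p * q)) x = poly (map_poly to_ac p) x * poly (map_poly to_ac q) x"
proof (induction p)
  case (pCons c p)
  then show ?case
    by (simp add: poly_map_to_ac_add map_poly_pCons map_poly_smult algebra_simps)
qed simp

lemma quad_elem_root:
  "poly (map_poly to_ac [:a\<^sup>2 - b\<^sup>2 * D, - (2 * a), 1:]) (quad_elem D a b) = 0"
proof -
  have "poly (map_poly to_ac [:a\<^sup>2 - b\<^sup>2 * D, - (2 * a), 1:]) (quad_elem D a b)
      = quad_elem D (a\<^sup>2 - b\<^sup>2 * D) 0 + quad_elem D a b * (quad_elem D (-2 * a) 0 + quad_elem D a b)"
    by (simp add: map_poly_pCons quad_elem_to_ac)
  also have "\<dots> = 0"
    unfolding quad_elem_mult quad_elem_add by (simp add: quad_elem_def power2_eq_square algebra_simps)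
  finally show ?thesis .
qed

text \<open>For \<open>b \<noteq> 0\<close> the quadratic is the minimal polynomial: the remainder
  of \<open>p\<close> has degree at most 1 and vanishes at an element outside the base field, so it
  is zero.\<close>

lemma quad_elem_min_poly_dvd:
  assumes "\<not> nonzero_square D" "D \<noteq> 0" "b \<noteq> 0"
    and root: "poly (map_poly to_ac p) (quad_elem D a b) = 0"
  shows "[:a\<^sup>2 - b\<^sup>2 * D, - (2 * a), 1:] dvd p"
proof -
  let ?f = "[:a\<^sup>2 - b\<^sup>2 * D, - (2 * a), 1:]"
  define r where "r = p mod ?f"
  have p: "p = ?f * (p div ?f) + r" unfolding r_def by (rule mult_div_mod_eq[symmetric])
  have r0: "poly (map_poly to_ac r) (quad_elem D a b) = 0"
    using root by (subst (asm) p) (simp only: poly_map_to_ac_add poly_map_to_ac_mult quad_elem_root, simp)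
  have "degree r < 2"
    using degree_mod_less[of ?f p] by (auto simp: r_def)
  then have r: "r = [:coeff r 0, coeff r 1:]"
    by (intro poly_eqI) (auto simp: coeff_pCons coeff_eq_0 numeral_2_eq_2 split: nat.split)
  have "quad_elem D (coeff r 0) 0 + quad_elem D a b * quad_elem D (coeff r 1) 0 = quad_elem D 0 0"
    using r0 by (subst (asm) r) (simp add: map_poly_pCons quad_elem_to_ac)
  then have "b * coeff r 1 = 0" "coeff r 0 + a * coeff r 1 = 0"
    unfolding quad_elem_mult quad_elem_add by (auto simp: quad_elem_eq_iff[OF assms(1,2)])
  then have "r = 0" using assms(3) by (subst r) auto
  then show ?thesis unfolding r_def by (simp add: mod_eq_0_iff_dvd)
qed

section \<open>Gauss's lemma and integral elements of a quadratic extension\<close>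

context nonarch_local_field
begin

text \<open>Input to Gauss's lemma: the first coefficient of minimal valuation cannot be cancelled
  in a product, and the leading coefficient 1 keeps the minimum at most 0.\<close>

lemma least_min_coeff:
  assumes "lead_coeff f = 1"
  obtains i where "ord (coeff f i) \<le> 0" "\<And>k. ord (coeff f i) \<le> ord (coeff f k)"
    "\<And>k. k < i \<Longrightarrow> ord (coeff f i) < ord (coeff f k)"
proof -
  define m where "m = Min ((\<lambda>k. ord (coeff f k)) ` {..degree f})"
  have min: "m \<le> ord (coeff f k)" for k
    by (cases "k \<le> degree f") (auto simp: m_def coeff_eq_0)
  have "m \<in> (\<lambda>k. ord (coeff f k)) ` {..degree f}"
    unfolding m_def by (rule Min_in) auto
  then have ex: "\<exists>k. ord (coeff f k) = m" by auto
  define i where "i = (LEAST k. ord (coeff f k) = m)"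
  have i: "ord (coeff f i) = m" unfolding i_def by (rule LeastI_ex[OF ex])
  show ?thesis
  proof (rule that[of i])
    show "ord (coeff f i) \<le> 0" using min[of "degree f"] assms i by simp
    show "ord (coeff f i) \<le> ord (coeff f k)" for k using min i by simp
    show "ord (coeff f i) < ord (coeff f k)" if "k < i" for k
      using not_less_Least[of k "\<lambda>k. ord (coeff f k) = m"] that min[of k] i
      unfolding i_def by (auto simp: less_le)
  qed
qed

text \<open>Gauss's lemma. In the coefficient of index \<open>i + j\<close> the product of the two
  first minimal coefficients has strictly smaller valuation than every other term. So the two
  nonpositive minima have a nonnegative sum, and both are 0.\<close>

lemma monic_factor_integral:
  assumes f: "lead_coeff f = 1" and g: "lead_coeff g = 1"
    and fg: "\<And>i. 0 \<le> ord (coeff (f * g) i)"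
  shows "0 \<le> ord (coeff f k)"
proof -
  obtain i where i: "ord (coeff f i) \<le> 0" "\<And>k. ord (coeff f i) \<le> ord (coeff f k)"
    "\<And>k. k < i \<Longrightarrow> ord (coeff f i) < ord (coeff f k)" using least_min_coeff[OF f] by blast
  obtain j where j: "ord (coeff g j) \<le> 0" "\<And>k. ord (coeff g j) \<le> ord (coeff g k)"
    "\<And>k. k < j \<Longrightarrow> ord (coeff g j) < ord (coeff g k)" using least_min_coeff[OF g] by blast
  obtain r where r: "ord (coeff f i) = ereal r" "r \<le> 0"
    using i(1) by (cases "ord (coeff f i)") auto
  obtain s where s: "ord (coeff g j) = ereal s" "s \<le> 0"
    using j(1) by (cases "ord (coeff g j)") auto
  have "ereal (r + s) < ord (\<Sum>l\<in>{..i + j} - {i}. coeff f l * coeff g (i + j - l))"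
  proof (rule ord_sum_gt)
    fix l assume l: "l \<in> {..i + j} - {i}"
    show "ereal (r + s) < ord (coeff f l * coeff g (i + j - l))"
    proof (cases "l < i")
      case True
      then show ?thesis using i(3) j(2) r s by (intro ord_mult_gt) auto
    next
      case False
      then have "i + j - l < j" using l by auto
      then show ?thesis using i(2) j(3) r s by (intro ord_mult_gt2) auto
    qed
  qed simp
  moreover have "ord (coeff f i * coeff g j) = ereal (r + s)" by (simp add: ord_mult r s)
  ultimately have "ord (coeff f i * coeff g j
      + (\<Sum>l\<in>{..i + j} - {i}. coeff f l * coeff g (i + j - l))) = ereal (r + s)"
    by (subst ord_add_eq) auto
  moreover have "coeff (f * g) (i + j) = coeff f i * coeff g j
      + (\<Sum>l\<in>{..i + j} - {i}. coeff f l * coeff g (i + j - l))"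
    unfolding coeff_mult by (subst sum.remove[of _ i]) auto
  ultimately have "0 \<le> r + s" using fg[of "i + j"] by simp
  then have "r = 0" using r s by auto
  then show ?thesis using i(2)[of k] r by (simp add: zero_ereal_def)
qed

text \<open>Trace and norm decide integrality, because by Gauss's lemma the minimal polynomial
  inherits integral coefficients from any monic integral multiple.\<close>

lemma quad_int_iff:
  assumes D: "\<not> nonzero_square D" "D \<noteq> 0"
  shows "quad_elem D a b \<in> quad_int ord D \<longleftrightarrow> 0 \<le> ord (2 * a) \<and> 0 \<le> ord (a\<^sup>2 - b\<^sup>2 * D)"
proof
  let ?f = "[:a\<^sup>2 - b\<^sup>2 * D, - (2 * a), 1:]"
  assume "quad_elem D a b \<in> quad_int ord D"
  then obtain p where p: "lead_coeff p = 1" "\<And>i. 0 \<le> ord (coeff p i)"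
    "poly (map_poly to_ac p) (quad_elem D a b) = 0"
    by (auto simp: quad_int_def val_ring_def)
  show "0 \<le> ord (2 * a) \<and> 0 \<le> ord (a\<^sup>2 - b\<^sup>2 * D)"
  proof (cases "b = 0")
    case False
    from quad_elem_min_poly_dvd[OF D False p(3)] obtain g where g: "p = ?f * g" by (elim dvdE)
    have "lead_coeff p = lead_coeff ?f * lead_coeff g" unfolding g by (rule lead_coeff_mult)
    then have "lead_coeff g = 1" using p(1) by simp
    then have "0 \<le> ord (coeff ?f k)" for k
      using p(2) unfolding g by (intro monic_factor_integral[of ?f g]) auto
    from this[of 0] this[of 1] show ?thesis by simp
  next
    \<comment> \<open>An element of the base field has a linear minimal polynomial, so the quadratic
      is replaced by \<open>[:-a, 1:]\<close>.\<close>
    case True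
    have "to_ac (poly q a) = poly (map_poly to_ac q) (to_ac a)" for q
      by (induction q) (auto simp: map_poly_pCons)
    from this[of p] have "to_ac (poly p a) = 0" using p(3) True by (simp add: quad_elem_to_ac)
    then have "poly p a = 0" by simp
    then have "[:-a, 1:] dvd p" by (simp only: poly_eq_0_iff_dvd)
    then obtain g where g: "p = [:-a, 1:] * g" by (elim dvdE)
    have "lead_coeff p = lead_coeff [:-a, 1:] * lead_coeff g" unfolding g by (rule lead_coeff_mult)
    then have "lead_coeff g = 1" using p(1) by simp
    then have "0 \<le> ord (coeff [:-a, 1:] k)" for k
      using p(2) unfolding g by (intro monic_factor_integral[of "[:-a, 1:]" g]) auto
    from this[of 0] have "0 \<le> ord a" by simp
    then show ?thesis using True by (simp add: ord_mult ord_power2)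
  qed
next
  let ?f = "[:a\<^sup>2 - b\<^sup>2 * D, - (2 * a), 1:]"
  assume "0 \<le> ord (2 * a) \<and> 0 \<le> ord (a\<^sup>2 - b\<^sup>2 * D)"
  then have "\<forall>i. coeff ?f i \<in> val_ring ord"
    by (auto simp: val_ring_def coeff_pCons split: nat.split)
  moreover have "lead_coeff ?f = 1" by simp
  ultimately show "quad_elem D a b \<in> quad_int ord D"
    unfolding quad_int_def using quad_elem_root[of a b D] quad_ext_iff by blast
qed

end

text \<open>
  Coordinates with respect to \<open>1\<close> and \<open>\<theta> = (s + \<surd>D / y) / 2\<close>, a root of \<open>X\<^sup>2 - s X + w\<close>
  if \<open>D = y\<^sup>2 (s\<^sup>2 - 4 w)\<close>.
\<close>

definition theta_elem :: "'a::field_char_0 \<Rightarrow> 'a \<Rightarrow> 'a \<Rightarrow> 'a \<Rightarrow> 'a \<Rightarrow> 'a alg_closure" where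
  "theta_elem D y s x z = quad_elem D (x + s * z / 2) (z / (2 * y))"

lemma theta_elem_exhaust:
  assumes "y \<noteq> 0"
  obtains x z where "quad_elem D a b = theta_elem D y s x z"
proof -
  have "quad_elem D a b = theta_elem D y s (a - s * (2 * y * b) / 2) (2 * y * b)"
    using assms by (simp add: theta_elem_def)
  then show ?thesis using that by blast
qed

lemma theta_elem_eq_iff:
  assumes "\<not> nonzero_square D" "D \<noteq> 0" "y \<noteq> 0"
  shows "theta_elem D y s x z = theta_elem D y s x' z' \<longleftrightarrow> x = x' \<and> z = z'"
  unfolding theta_elem_def quad_elem_eq_iff[OF assms(1,2)] using assms(3) by auto

lemma theta_elem_mult:
  assumes "D = y\<^sup>2 * (s\<^sup>2 - 4 * w)" "y \<noteq> 0"
  shows "theta_elem D y s x z * theta_elem D y s x' z' =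
    theta_elem D y s (x * x' - w * z * z') (x * z' + x' * z + s * z * z')"
proof -
  have "z / (2 * y) * (z' / (2 * y)) * D = z * z' * (s\<^sup>2 - 4 * w) / 4"
    using assms(2) unfolding assms(1) by (simp add: field_simps power2_eq_square)
  moreover have "(x + s * z / 2) * (x' + s * z' / 2) + z * z' * (s\<^sup>2 - 4 * w) / 4
      = x * x' - w * z * z' + s * (x * z' + x' * z + s * z * z') / 2"
    by (simp add: field_simps power2_eq_square)
  ultimately have "(x + s * z / 2) * (x' + s * z' / 2) + z / (2 * y) * (z' / (2 * y)) * D
      = x * x' - w * z * z' + s * (x * z' + x' * z + s * z * z') / 2"
    by (simp only:)
  moreover have "(x + s * z / 2) * (z' / (2 * y)) + (x' + s * z' / 2) * (z / (2 * y))
      = (x * z' + x' * z + s * z * z') / (2 * y)"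
    using assms(2) by (simp add: field_simps)
  ultimately show ?thesis unfolding theta_elem_def quad_elem_mult by (simp only:)
qed

lemma to_ac_mult_theta_elem:
  "to_ac c * theta_elem D y s x z = theta_elem D y s (c * x) (c * z)"
  by (simp add: theta_elem_def quad_elem_def algebra_simps)

lemma theta_elem_1: "theta_elem D y s 1 0 = 1"
  by (simp add: theta_elem_def quad_elem_def)

text \<open>The norm of \<open>x + z \<theta>\<close>, since \<theta> has trace \<open>s\<close> and
  norm \<open>w\<close>.\<close>

definition theta_norm :: "'a::field_char_0 \<Rightarrow> 'a \<Rightarrow> 'a \<Rightarrow> 'a \<Rightarrow> 'a" where
  "theta_norm s w x z = x\<^sup>2 + s * x * z + w * z\<^sup>2"

lemma theta_norm_eq:
  assumes "D = y\<^sup>2 * (s\<^sup>2 - 4 * w)" "y \<noteq> 0"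
  shows "(x + s * z / 2)\<^sup>2 - (z / (2 * y))\<^sup>2 * D = theta_norm s w x z"
proof -
  have "(z / (2 * y))\<^sup>2 * D = z\<^sup>2 * (s\<^sup>2 - 4 * w) / 4"
    using assms(2) unfolding assms(1) by (simp add: field_simps power2_eq_square)
  then show ?thesis by (simp add: theta_norm_def field_simps power2_eq_square)
qed

lemma quad_disc_theta_elem:
  fixes D :: "'a::field_char_0"
  assumes "\<not> nonzero_square D" "D \<noteq> 0" "D = y\<^sup>2 * (s\<^sup>2 - 4 * w)" "y \<noteq> 0"
  shows "quad_disc D (theta_elem D y s x z) (theta_elem D y s x' z') =
    (x * z' - x' * z)\<^sup>2 * (s\<^sup>2 - 4 * w)"
proof -
  have "(x + s * z / 2) * (z' / (2 * y)) - (x' + s * z' / 2) * (z / (2 * y)) = (x * z' - x' * z) / (2 * y)"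
    using assms(4) by (simp add: field_simps)
  then have "quad_disc D (theta_elem D y s x z) (theta_elem D y s x' z')
      = 4 * D * ((x * z' - x' * z) / (2 * y))\<^sup>2"
    by (simp only: theta_elem_def quad_disc_quad_elem[OF assms(1,2)])
  also have "\<dots> = (x * z' - x' * z)\<^sup>2 * (s\<^sup>2 - 4 * w)"
  proof -
    have "4 * (y\<^sup>2 * d) * (r / (2 * y))\<^sup>2 = r\<^sup>2 * d" for r d :: 'a
      using assms(4) by (simp add: field_simps power2_eq_square)
    then show ?thesis by (simp only: assms(3))
  qed
  finally show ?thesis .
qed

section \<open>Integrality in coordinates\<close>

context nonarch_local_field
begin

text \<open>The squared trace minus four times the norm is \<open>z\<^sup>2\<close> times the
  discriminant, so a unit discriminant forces \<open>z\<close> to be integral. Then \<open>x\<close>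
  is a root of a monic integral quadratic.\<close>

lemma theta_norm_integralD_unit:
  assumes "0 \<le> ord s" "0 \<le> ord w" "ord (s\<^sup>2 - 4 * w) = 0"
    and t: "0 \<le> ord (2 * x + s * z)" and n: "0 \<le> ord (theta_norm s w x z)"
  shows "0 \<le> ord x" "0 \<le> ord z"
proof -
  have "z\<^sup>2 * (s\<^sup>2 - 4 * w) = (2 * x + s * z) * (2 * x + s * z) - 4 * theta_norm s w x z"
    by (simp add: theta_norm_def algebra_simps power2_eq_square)
  also have "0 \<le> ord \<dots>"
    using t n by (intro ord_diff_ge ord_mult_ge0) auto
  finally have "0 \<le> ord z + ord z" by (simp add: ord_mult assms ord_power2)
  then show z: "0 \<le> ord z" by (cases "ord z") auto
  have "x\<^sup>2 + s * z * x + (w * z\<^sup>2 - theta_norm s w x z) = 0"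
    by (simp add: theta_norm_def algebra_simps)
  then show "0 \<le> ord x"
    by (rule ord_integral_poly_root)
       (use z n assms in \<open>auto simp: power2_eq_square intro!: ord_diff_ge ord_mult_ge0\<close>)
qed

text \<open>For nonzero coordinates \<open>x\<^sup>2\<close> has even and
  \<open>w * z\<^sup>2\<close> odd valuation, and the mixed term lies above the smaller of the two.
  Nothing cancels, so both squares inherit integrality from the norm;
  \<open>0 \<le> 2 * l + 1\<close> still yields \<open>0 \<le> l\<close>.\<close>

lemma theta_norm_integralD_eisenstein:
  assumes "1 \<le> ord s" "ord w = 1" and n: "0 \<le> ord (theta_norm s w x z)"
  shows "0 \<le> ord x" "0 \<le> ord z"
proof -
  have "0 \<le> ord x \<and> 0 \<le> ord z"
  proof (cases "x = 0 \<or> z = 0")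
    case True
    then have "0 \<le> ord x + ord x \<or> x = 0" "0 \<le> 1 + (ord z + ord z) \<or> z = 0"
      using n assms by (auto simp: theta_norm_def ord_mult ord_power2)
    then have "0 \<le> ord x" "z = 0 \<or> (\<exists>k::int. ord z = ereal (of_int k) \<and> 0 \<le> 1 + 2 * k)"
      using ord_integral[of z] by (cases "ord x"; force simp: one_ereal_def zero_ereal_def)+
    then show ?thesis by (auto simp: zero_ereal_def)
  next
    case False
    obtain k l :: int where k: "ord x = ereal (of_int k)" and l: "ord z = ereal (of_int l)"
      using False by (meson ord_integral)
    have xx: "ord (x\<^sup>2) = ereal (of_int (2 * k))" by (simp add: ord_power2 k)
    have zz: "ord (w * z\<^sup>2) = ereal (of_int (2 * l + 1))"
      by (simp add: ord_mult ord_power2 l assms one_ereal_def)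
    have "ereal (1 + of_int k + of_int l) \<le> ord (s * x * z)"
      using assms k l by (intro ord_mult_ge) (auto simp: one_ereal_def)
    then have sxz: "ereal (of_int (1 + k + l)) \<le> ord (s * x * z)" by simp
    have eq: "theta_norm s w x z = (x\<^sup>2 + w * z\<^sup>2) + s * x * z" by (simp add: theta_norm_def)
    show ?thesis
    proof (cases "k \<le> l")
      case True
      then have "ord (x\<^sup>2 + w * z\<^sup>2) = ereal (of_int (2 * k))"
        using xx zz by (subst ord_add_eq) auto
      moreover have "ereal (of_int (2 * k)) < ord (s * x * z)"
        by (rule less_le_trans[OF _ sxz]) (use True in simp)
      ultimately have "ord (theta_norm s w x z) = ereal (of_int (2 * k))"
        unfolding eq by (subst ord_add_eq) auto
      then have "0 \<le> k" using n by simp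
      then show ?thesis using True k l by simp
    next
      case False
      then have "real_of_int (2 * l + 1) < real_of_int (2 * k)" by linarith
      then have "ord (x\<^sup>2 + w * z\<^sup>2) = ereal (of_int (2 * l + 1))"
        using xx zz by (subst ord_add_eq2) auto
      moreover have "ereal (of_int (2 * l + 1)) < ord (s * x * z)"
        by (rule less_le_trans[OF _ sxz]) (use False in simp)
      ultimately have "ord (theta_norm s w x z) = ereal (of_int (2 * l + 1))"
        unfolding eq by (subst ord_add_eq) auto
      then have "0 \<le> real_of_int (2 * l + 1)" using n by simp
      then have "0 \<le> l" by linarith
      then show ?thesis using False k l by simp
    qed
  qed
  then show "0 \<le> ord x" "0 \<le> ord z" by auto
qed

end

text \<open>
  The two kinds of monic integral quadratic polynomials \<open>X\<^sup>2 - s X + w\<close> whose root generates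
  the ring of integers: unit discriminant, or Eisenstein.
\<close>

definition unit_disc :: "('a::field_char_0 \<Rightarrow> ereal) \<Rightarrow> 'a \<Rightarrow> 'a \<Rightarrow> bool" where
  "unit_disc ord s w \<longleftrightarrow> 0 \<le> ord s \<and> 0 \<le> ord w \<and> ord (s\<^sup>2 - 4 * w) = 0"

definition eisenstein :: "('a::field_char_0 \<Rightarrow> ereal) \<Rightarrow> 'a \<Rightarrow> 'a \<Rightarrow> bool" where
  "eisenstein ord s w \<longleftrightarrow> 1 \<le> ord s \<and> ord w = 1"

section \<open>Discriminant ideal and ramification\<close>

context nonarch_local_field
begin

text \<open>With 1 and \<theta> as an integral basis, discriminants and units can be read off from
  coordinates.\<close>

lemma quad_int_theta:
  assumes D: "\<not> nonzero_square D" "D \<noteq> 0" "D = y\<^sup>2 * (s\<^sup>2 - 4 * w)" "y \<noteq> 0"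
    and sw: "unit_disc ord s w \<or> eisenstein ord s w"
  shows "theta_elem D y s x z \<in> quad_int ord D \<longleftrightarrow> 0 \<le> ord x \<and> 0 \<le> ord z"
proof -
  have eq: "2 * (x + s * z / 2) = 2 * x + s * z" by (simp add: field_simps)
  have iff: "theta_elem D y s x z \<in> quad_int ord D \<longleftrightarrow>
      0 \<le> ord (2 * x + s * z) \<and> 0 \<le> ord (theta_norm s w x z)"
    unfolding theta_elem_def quad_int_iff[OF D(1,2)] theta_norm_eq[OF D(3,4)] eq ..
  have sw0: "0 \<le> ord s" "0 \<le> ord w"
    using sw by (auto simp: unit_disc_def eisenstein_def intro: one_le_imp_zero_le_ereal)
  show ?thesis
  proof
    assume "theta_elem D y s x z \<in> quad_int ord D"
    then show "0 \<le> ord x \<and> 0 \<le> ord z"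
      using sw unfolding iff unit_disc_def eisenstein_def
      using theta_norm_integralD_unit theta_norm_integralD_eisenstein by blast
  next
    assume "0 \<le> ord x \<and> 0 \<le> ord z"
    then show "theta_elem D y s x z \<in> quad_int ord D"
      unfolding iff theta_norm_def power2_eq_square
      using sw0 by (intro conjI ord_add_ge ord_mult_ge0) auto
  qed
qed

lemma quad_int_thetaE:
  assumes D: "\<not> nonzero_square D" "D \<noteq> 0" "D = y\<^sup>2 * (s\<^sup>2 - 4 * w)" "y \<noteq> 0"
    and sw: "unit_disc ord s w \<or> eisenstein ord s w"
    and A: "A \<in> quad_int ord D"
  obtains x z where "A = theta_elem D y s x z" "0 \<le> ord x" "0 \<le> ord z"
proof -
  obtain a b where "A = quad_elem D a b" using A by (auto simp: quad_int_def quad_ext_iff)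
  then obtain x z where "A = theta_elem D y s x z" using theta_elem_exhaust[OF D(4)] by metis
  then show ?thesis using that A quad_int_theta[OF D sw] by blast
qed

lemma ord_ideal_eq: "ord_ideal ord {x. ereal (real k) \<le> ord x} = k"
  unfolding ord_ideal_def
proof (rule the_equality)
  fix m assume eq: "{x. ereal (real k) \<le> ord x} = {x. ereal (real m) \<le> ord x}"
  have pk: "ord (\<pi> ^ j) = ereal (real j)" for j
    using ord_power[of \<pi> 1] ord_prime_element by (simp add: one_ereal_def)
  have "\<pi> ^ k \<in> {x. ereal (real m) \<le> ord x}" unfolding eq[symmetric] by (simp add: pk)
  moreover have "\<pi> ^ m \<in> {x. ereal (real k) \<le> ord x}" unfolding eq by (simp add: pk)
  ultimately show "m = k" by (simp add: pk)
qed simp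

text \<open>Another pair of integers multiplies the discriminant of the pair 1, \<theta> by the
  square of the integral determinant \<open>x * z' - x' * z\<close>. So the ideal is generated by
  the single element \<open>s\<^sup>2 - 4 * w\<close>.\<close>

lemma disc_ideal_theta:
  assumes D: "\<not> nonzero_square D" "D \<noteq> 0" "D = y\<^sup>2 * (s\<^sup>2 - 4 * w)" "y \<noteq> 0"
    and sw: "unit_disc ord s w \<or> eisenstein ord s w"
  shows "disc_ideal ord D = {x. ord (s\<^sup>2 - 4 * w) \<le> ord x}"
proof -
  let ?d = "s\<^sup>2 - 4 * w"
  let ?S = "{quad_disc D x y | x y. x \<in> quad_int ord D \<and> y \<in> quad_int ord D}"
  have sw0: "0 \<le> ord s" "0 \<le> ord w"
    using sw by (auto simp: unit_disc_def eisenstein_def intro: one_le_imp_zero_le_ereal)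
  have d0: "0 \<le> ord ?d" unfolding power2_eq_square using sw0 by (intro ord_diff_ge ord_mult_ge0) auto
  have dne: "?d \<noteq> 0" using D by auto
  have "val_ring_ideal ord hull ?S = {x. ord ?d \<le> ord x}"
  proof (rule hull_unique)
    show "?S \<subseteq> {x. ord ?d \<le> ord x}"
    proof clarify
      fix A Z assume XZ: "A \<in> quad_int ord D" "Z \<in> quad_int ord D"
      obtain x z where A: "A = theta_elem D y s x z" and xz: "0 \<le> ord x" "0 \<le> ord z"
        using quad_int_thetaE[OF D sw XZ(1)] .
      obtain x' z' where Z: "Z = theta_elem D y s x' z'" and xz': "0 \<le> ord x'" "0 \<le> ord z'"
        using quad_int_thetaE[OF D sw XZ(2)] .
      have "0 \<le> ord ((x * z' - x' * z)\<^sup>2)"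
        unfolding power2_eq_square using xz xz' by (intro ord_mult_ge0 ord_diff_ge)
      then show "ord ?d \<le> ord (quad_disc D A Z)"
        unfolding A Z quad_disc_theta_elem[OF D] ord_mult
        using add_mono[of 0 "ord ((x * z' - x' * z)\<^sup>2)" "ord ?d" "ord ?d"] by simp
    qed
    show "val_ring_ideal ord {x. ord ?d \<le> ord x}"
      unfolding val_ring_ideal_def val_ring_def
      using d0 add_mono[of 0 _ "ord ?d"] by (auto intro: ord_add_ge simp: ord_mult)
    fix I assume S: "?S \<subseteq> I" and I: "val_ring_ideal ord I"
    have "quad_disc D (theta_elem D y s 1 0) (theta_elem D y s 0 1) \<in> ?S"
      using quad_int_theta[OF D sw] by (intro CollectI exI conjI refl) auto
    then have "?d \<in> I" using S unfolding quad_disc_theta_elem[OF D] by auto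
    show "{x. ord ?d \<le> ord x} \<subseteq> I"
    proof clarify
      fix x assume x: "ord ?d \<le> ord x"
      obtain k where k: "ord ?d = ereal k" using ord_nonzeroE[OF dne] by blast
      have "0 \<le> ord (x / ?d)"
        unfolding ord_divide[OF k] using x k by (cases "ord x") auto
      then have "x / ?d * ?d \<in> I"
        using I \<open>?d \<in> I\<close> unfolding val_ring_ideal_def val_ring_def by blast
      then show "x \<in> I" using dne by simp
    qed
  qed
  then show ?thesis using D(1) by (simp add: disc_ideal_def)
qed

text \<open>A non-unit has a norm of positive valuation. Were its coordinate \<open>z\<close> a
  unit, \<open>- x / z\<close> would be a simple root modulo the maximal ideal, and lifting it would
  make \<open>D\<close> a square. So both coordinates of a non-unit are divisible by
  \<open>\<pi>\<close>.\<close>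

lemma unit_disc_unramified:
  assumes D: "\<not> nonzero_square D" "D \<noteq> 0" "D = y\<^sup>2 * (s\<^sup>2 - 4 * w)" "y \<noteq> 0"
    and sw: "unit_disc ord s w"
  shows "unramified_quad ord D"
proof -
  let ?th = "theta_elem D y s"
  have sw': "unit_disc ord s w \<or> eisenstein ord s w" using sw by simp
  have sw0: "0 \<le> ord s" "0 \<le> ord w" "ord (s\<^sup>2 - 4 * w) = 0"
    using sw by (auto simp: unit_disc_def)
  note int = quad_int_theta[OF D sw']
  have nonunit: "\<exists>c x' z'. 0 < ord c \<and> 0 \<le> ord x' \<and> 0 \<le> ord z' \<and> ?th x z = to_ac c * ?th x' z'"
    if xz: "0 \<le> ord x" "0 \<le> ord z" and nu: "\<not> (\<exists>Y \<in> quad_int ord D. ?th x z * Y = 1)" for x z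
  proof -
    let ?n = "theta_norm s w x z"
    have n0: "0 \<le> ord ?n"
      unfolding theta_norm_def power2_eq_square using xz sw0 by (intro ord_add_ge ord_mult_ge0)
    have n: "0 < ord ?n"
    proof (rule ccontr)
      assume "\<not> 0 < ord ?n"
      then have n: "ord ?n = ereal 0" using n0 by (simp add: zero_ereal_def)
      then have ne: "?n \<noteq> 0" by auto
      \<comment> \<open>The conjugate \<open>(x + s z) - z \<theta>\<close> divided by the
        norm.\<close>
      let ?Y = "?th ((x + s * z) / ?n) (- z / ?n)"
      have "?Y \<in> quad_int ord D"
        unfolding int ord_divide[OF n] using xz sw0
        by (auto simp flip: zero_ereal_def intro!: ord_add_ge ord_mult_ge0)
      moreover have "?th x z * ?Y = 1"
      proof -
        have "x * ((x + s * z) / ?n) - w * z * (- z / ?n) = ?n / ?n"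
          using ne by (simp add: field_simps) (simp add: theta_norm_def algebra_simps power2_eq_square)
        moreover have "x * (- z / ?n) + (x + s * z) / ?n * z + s * z * (- z / ?n) = 0"
          using ne by (simp add: field_simps)
        ultimately show ?thesis
          unfolding theta_elem_mult[OF D(3,4)] using ne by (simp add: theta_elem_1)
      qed
      ultimately show False using nu by blast
    qed
    have z: "0 < ord z"
    proof (rule ccontr)
      assume "\<not> 0 < ord z"
      then have z: "ord z = ereal 0" using xz by (simp add: zero_ereal_def)
      then have zne: "z \<noteq> 0" by auto
      define r where "r = - x / z"
      have r: "r\<^sup>2 - s * r + w = ?n / z\<^sup>2"
        using zne by (simp add: r_def theta_norm_def field_simps power2_eq_square)
      have n': "0 < ord (?n / z\<^sup>2)"
        using n ord_divide[of "z\<^sup>2" 0 ?n] z by (simp add: ord_power2 flip: zero_ereal_def)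
      have r0: "0 \<le> ord r" using xz ord_divide[OF z] by (simp add: r_def flip: zero_ereal_def)
      \<comment> \<open>The squared derivative at \<open>r\<close> is the discriminant plus four
        times the value at \<open>r\<close>, hence a unit.\<close>
      have "(2 * r - s)\<^sup>2 = (s\<^sup>2 - 4 * w) + 4 * (?n / z\<^sup>2)"
        unfolding r[symmetric] by (simp add: algebra_simps power2_eq_square)
      also have "ord \<dots> = 0"
      proof (subst ord_add_eq)
        have "ereal (0 + 0) < ord (4 * (?n / z\<^sup>2))"
          by (rule ord_mult_gt2) (use n' in \<open>simp_all flip: zero_ereal_def\<close>)
        then show "ord (s\<^sup>2 - 4 * w) < ord (4 * (?n / z\<^sup>2))"
          by (simp add: sw0 flip: zero_ereal_def)
      qed (simp add: sw0)
      finally have "ord (2 * r - s) = 0"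
        by (cases "ord (2 * r - s)") (auto simp: ord_power2 zero_ereal_def)
      then obtain t where "t\<^sup>2 - s * t + w = 0"
        using hensel_quadratic[of r s w] n' r by auto
      then have "w = s * t - t\<^sup>2" by (simp add: algebra_simps)
      then have "D = (y * (2 * t - s))\<^sup>2"
        unfolding D(3) \<open>w = s * t - t\<^sup>2\<close> by (simp add: algebra_simps power2_eq_square)
      then show False using D(1,2) unfolding nonzero_square_def by (metis power_zero_numeral)
    qed
    have x: "0 < ord x"
    proof -
      have "x\<^sup>2 = ?n - z * (s * x + w * z)"
        by (simp add: theta_norm_def algebra_simps power2_eq_square)
      also have "ereal 0 < ord \<dots>"
      proof (rule ord_diff_gt)
        have "ereal (0 + 0) < ord (z * (s * x + w * z))"
          using z xz sw0 by (intro ord_mult_gt) (auto simp flip: zero_ereal_def intro!: ord_add_ge ord_mult_ge0)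
        then show "ereal 0 < ord (z * (s * x + w * z))" by simp
      qed (use n in \<open>simp flip: zero_ereal_def\<close>)
      finally show ?thesis by (cases "ord x") (auto simp: ord_power2)
    qed
    have p: "ord \<pi> = ereal 1" using ord_prime_element by (simp add: one_ereal_def)
    have "0 \<le> ord (x / \<pi>)" "0 \<le> ord (z / \<pi>)"
      using ord_gt_0[OF x] ord_gt_0[OF z] unfolding ord_divide[OF p]
      by (cases "ord x"; cases "ord z"; simp add: one_ereal_def)+
    moreover have "?th x z = to_ac \<pi> * ?th (x / \<pi>) (z / \<pi>)"
      by (simp add: to_ac_mult_theta_elem)
    ultimately show ?thesis using ord_prime_element
      by (intro exI[of _ \<pi>] exI[of _ "x / \<pi>"] exI[of _ "z / \<pi>"]) auto
  qed
  have "{A \<in> quad_int ord D. \<not> (\<exists>Y \<in> quad_int ord D. A * Y = 1)} =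
     {to_ac c * Y | c Y. c \<in> val_ideal ord \<and> Y \<in> quad_int ord D}" (is "?L = ?R")
  proof (intro equalityI subsetI)
    fix A assume A: "A \<in> ?L"
    then obtain x z where xz: "A = ?th x z" "0 \<le> ord x" "0 \<le> ord z"
      using quad_int_thetaE[OF D sw'] by blast
    obtain c x' z' where c: "0 < ord c" "0 \<le> ord x'" "0 \<le> ord z'" "A = to_ac c * ?th x' z'"
      using nonunit[OF xz(2,3)] A xz(1) by blast
    then show "A \<in> ?R" using int[of x' z'] by (auto simp: val_ideal_def)
  next
    fix A assume "A \<in> ?R"
    then obtain c Y where c: "A = to_ac c * Y" "0 < ord c" "Y \<in> quad_int ord D"
      by (auto simp: val_ideal_def)
    then obtain x z where xz: "Y = ?th x z" "0 \<le> ord x" "0 \<le> ord z"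
      using quad_int_thetaE[OF D sw'] by blast
    have A: "A = ?th (c * x) (c * z)" by (simp add: c xz to_ac_mult_theta_elem)
    have "A \<in> quad_int ord D" unfolding A int using c xz by (auto intro: ord_mult_ge0)
    moreover have False if Z: "Z \<in> quad_int ord D" and XZ: "A * Z = 1" for Z
    proof -
      obtain x' z' where xz': "Z = ?th x' z'" "0 \<le> ord x'" "0 \<le> ord z'"
        using quad_int_thetaE[OF D sw' Z] by blast
      have "?th 1 0 = ?th (c * x * x' - w * (c * z) * z') (c * x * z' + x' * (c * z) + s * (c * z) * z')"
        using XZ unfolding A xz' theta_elem_mult[OF D(3,4)] by (simp add: theta_elem_1)
      then have "1 = c * (x * x' - w * z * z')"
        unfolding theta_elem_eq_iff[OF D(1,2,4)] by (simp add: algebra_simps)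
      moreover have "ereal (0 + 0) < ord (c * (x * x' - w * z * z'))"
        using c xz xz' sw0 by (intro ord_mult_gt) (auto simp flip: zero_ereal_def intro!: ord_diff_ge ord_mult_ge0)
      ultimately show False by (metis add_0 less_irrefl ord_1 zero_ereal_def)
    qed
    ultimately show "A \<in> ?L" by blast
  qed
  then show ?thesis unfolding unramified_quad_def using D(1) by simp
qed

text \<open>If \<open>D\<close> were a square, the polynomial would split with integral roots
  \<open>a\<close> and \<open>b\<close>. From \<open>ord a + ord b = 1\<close> exactly one of them
  is a unit, and then so is their sum \<open>s\<close>, which is impossible.\<close>

lemma eisenstein_not_square:
  assumes "D \<noteq> 0" "D = y\<^sup>2 * (s\<^sup>2 - 4 * w)" "y \<noteq> 0" and sw: "eisenstein ord s w"
  shows "\<not> nonzero_square D"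
proof
  assume "nonzero_square D"
  then obtain q where q: "D = q\<^sup>2" by (auto simp: nonzero_square_def)
  define e where "e = q / y"
  define a where "a = (s - e) / 2"
  define b where "b = (s + e) / 2"
  have ab: "a + b = s" by (simp add: a_def b_def field_simps)
  have "s\<^sup>2 - 4 * w = e\<^sup>2" using assms q by (simp add: e_def power_divide field_simps)
  moreover have "4 * (a * b) = s\<^sup>2 - e\<^sup>2"
    by (simp add: a_def b_def field_simps power2_eq_square)
  ultimately have "4 * (a * b) = 4 * w" by (simp add: algebra_simps)
  then have w: "a * b = w" by simp
  have sw0: "1 \<le> ord s" "ord w = 1" using sw by (auto simp: eisenstein_def)
  have "a\<^sup>2 + (- s) * a + w = 0" "b\<^sup>2 + (- s) * b + w = 0"
    unfolding ab[symmetric] w[symmetric] by (simp_all add: algebra_simps power2_eq_square)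
  from this[THEN ord_integral_poly_root] have ab0: "0 \<le> ord a" "0 \<le> ord b"
    using sw0 by (auto intro: one_le_imp_zero_le_ereal)
  have w1: "ord a + ord b = 1" using sw0 w by (metis ord_mult)
  then have ne: "a \<noteq> 0" "b \<noteq> 0" by auto
  obtain k l :: int where k: "ord a = ereal (of_int k)" and l: "ord b = ereal (of_int l)"
    using ne by (meson ord_integral)
  have "real_of_int (k + l) = 1" "0 \<le> k" "0 \<le> l" using w1 ab0 k l by (auto simp: one_ereal_def)
  then have "k + l = 1" by linarith
  with \<open>0 \<le> k\<close> \<open>0 \<le> l\<close> have "k = 0 \<and> l = 1 \<or> k = 1 \<and> l = 0" by linarith
  then have "ord (a + b) = ereal 0" using ord_add_eq[of a b] ord_add_eq2[of b a] k l by auto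
  then show False using sw0 ab by (simp add: one_ereal_def)
qed

text \<open>Every integral multiple of \<theta> has its first coordinate divisible by
  \<open>w\<close>, so \<theta> is no unit. Its second coordinate is 1, so it is not in the ideal
  generated by the maximal ideal of the base.\<close>

lemma eisenstein_ramified:
  assumes D: "\<not> nonzero_square D" "D \<noteq> 0" "D = y\<^sup>2 * (s\<^sup>2 - 4 * w)" "y \<noteq> 0"
    and sw: "eisenstein ord s w"
  shows "\<not> unramified_quad ord D"
proof
  let ?th = "theta_elem D y s"
  have sw': "unit_disc ord s w \<or> eisenstein ord s w" using sw by simp
  have sw0: "1 \<le> ord s" "ord w = 1" using sw by (auto simp: eisenstein_def)
  have s0: "0 \<le> ord s" using sw0 by (intro one_le_imp_zero_le_ereal)
  note int = quad_int_theta[OF D sw']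
  assume "unramified_quad ord D"
  then have unr: "{A \<in> quad_int ord D. \<not> (\<exists>Y \<in> quad_int ord D. A * Y = 1)} =
     {to_ac c * Y | c Y. c \<in> val_ideal ord \<and> Y \<in> quad_int ord D}"
    by (simp add: unramified_quad_def)
  have "?th 0 1 \<in> quad_int ord D" unfolding int by simp
  moreover have False if Z: "Z \<in> quad_int ord D" and XZ: "?th 0 1 * Z = 1" for Z
  proof -
    obtain x' z' where xz': "Z = ?th x' z'" "0 \<le> ord x'" "0 \<le> ord z'"
      using quad_int_thetaE[OF D sw' Z] by blast
    have "?th 1 0 = ?th (- (w * z')) (x' + s * z')"
      using XZ unfolding xz' theta_elem_mult[OF D(3,4)] by (simp add: theta_elem_1)
    then have "1 = - (w * z')" unfolding theta_elem_eq_iff[OF D(1,2,4)] by simp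
    then have "ord w + ord z' = 0" using ord_minus[of "w * z'"] by (simp add: ord_mult)
    then show False using sw0 xz' by (cases "ord z'") (auto simp: one_ereal_def zero_ereal_def)
  qed
  ultimately have "?th 0 1 \<in> {to_ac c * Y | c Y. c \<in> val_ideal ord \<and> Y \<in> quad_int ord D}"
    unfolding unr[symmetric] by blast
  then obtain c Y where c: "?th 0 1 = to_ac c * Y" "0 < ord c" "Y \<in> quad_int ord D"
    by (auto simp: val_ideal_def)
  then obtain x z where xz: "Y = ?th x z" "0 \<le> ord x" "0 \<le> ord z"
    using quad_int_thetaE[OF D sw'] by blast
  then have "1 = c * z"
    using c unfolding xz to_ac_mult_theta_elem theta_elem_eq_iff[OF D(1,2,4)] by simp
  then have "ord c + ord z = 0" by (metis ord_1 ord_mult)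
  then show False using c xz by (cases "ord c"; cases "ord z") auto
qed

end

section \<open>Symmetric forms and Schur complements\<close>

lemma sum_lessThan_add:
  "(\<Sum>i<k + m. f i) = (\<Sum>i<k. f i) + (\<Sum>i<(m::nat). f (k + i) :: 'a::comm_monoid_add)"
  by (induction m) (auto simp: algebra_simps)

definition bil :: "nat \<Rightarrow> (nat \<Rightarrow> nat \<Rightarrow> 'a::field) \<Rightarrow> (nat \<Rightarrow> 'a) \<Rightarrow> (nat \<Rightarrow> 'a) \<Rightarrow> 'a" where
  "bil n T x y = (\<Sum>i<n. \<Sum>j<n. x i * T i j * y j)"

lemma bil_eq: "bil n T x y = (\<Sum>i<n. x i * (\<Sum>j<n. T i j * y j))"
  by (simp add: bil_def sum_distrib_left mult.assoc)

lemma bil_add: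
  "bil n T (\<lambda>i. x i + y i) (\<lambda>i. x i + y i) = bil n T x x + bil n T x y + bil n T y x + bil n T y y"
  by (simp add: bil_def algebra_simps sum.distrib)

lemma bil_scale: "bil n T (\<lambda>i. c * x i) (\<lambda>i. c * x i) = c\<^sup>2 * bil n T x x"
  by (simp add: bil_def sum_distrib_left algebra_simps power2_eq_square)

lemma bil_sym: "(\<And>i j. i < n \<Longrightarrow> j < n \<Longrightarrow> T i j = T j i) \<Longrightarrow> bil n T x y = bil n T y x"
  unfolding bil_def by (subst sum.swap) (auto intro!: sum.cong simp: mult_ac)

lemma bil_Suc:
  assumes "\<And>i j. i \<le> n \<Longrightarrow> j \<le> n \<Longrightarrow> T i j = T j i"
  shows "bil (Suc n) T x x = bil n T x x + 2 * (x n * (\<Sum>j<n. T n j * x j)) + x n * T n n * x n"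
proof -
  have "(\<Sum>i<n. x i * T i n * x n) = x n * (\<Sum>j<n. T n j * x j)"
    unfolding sum_distrib_left by (rule sum.cong) (auto simp: assms[of _ n] mult_ac)
  moreover have "(\<Sum>j<n. x n * T n j * x j) = x n * (\<Sum>j<n. T n j * x j)"
    by (simp add: sum_distrib_left mult_ac)
  ultimately show ?thesis by (simp add: bil_def sum.distrib)
qed

text \<open>The identity matrix with column \<open>i\<close> replaced by \<open>z\<close>. The row
  index precedes the column index; fixing the latter gives a vector of the new basis.\<close>

definition col_subst :: "nat \<Rightarrow> (nat \<Rightarrow> 'b::field) \<Rightarrow> nat \<Rightarrow> nat \<Rightarrow> 'b" where
  "col_subst i z l k = (if k = i then z l else if l = k then 1 else 0)"

lemma row_col_subst:
  assumes "k < n"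
  shows "(\<Sum>j<n. f j * col_subst i z j k) = (if k = i then (\<Sum>j<n. f j * z j) else f k)"
  using assms by (simp add: col_subst_def if_distrib[of "\<lambda>x. _ * x"] cong: if_cong)

lemma bil_col_subst:
  assumes "k < n" "l < n" "\<And>i j. i < n \<Longrightarrow> j < n \<Longrightarrow> T i j = T j i"
  shows "bil n T (\<lambda>j. col_subst i z j k) (\<lambda>j. col_subst i z j l) =
    (if k = i then if l = i then bil n T z z else (\<Sum>j<n. T l j * z j)
     else if l = i then (\<Sum>j<n. T k j * z j) else T k l)"
proof -
  have "bil n T (\<lambda>j. col_subst i z j k) (\<lambda>j. col_subst i z j l)
      = (\<Sum>j<n. (\<Sum>m<n. T j m * col_subst i z m l) * col_subst i z j k)"
    by (simp add: bil_eq mult.commute)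
  also have "\<dots> = (if k = i then (\<Sum>j<n. (\<Sum>m<n. T j m * col_subst i z m l) * z j)
      else (\<Sum>m<n. T k m * col_subst i z m l))"
    by (rule row_col_subst[OF assms(1)])
  also have "\<dots> = (if k = i then if l = i then bil n T z z else (\<Sum>j<n. T j l * z j)
     else if l = i then (\<Sum>j<n. T k j * z j) else T k l)"
    unfolding row_col_subst[OF assms(2)] by (simp add: bil_eq mult.commute)
  also have "(\<Sum>j<n. T j l * z j) = (\<Sum>j<n. T l j * z j)"
    using assms by (intro sum.cong) auto
  finally show ?thesis .
qed

section \<open>Determinants and Schur complements of entry functions\<close>

definition dt :: "nat \<Rightarrow> (nat \<Rightarrow> nat \<Rightarrow> 'a::comm_ring_1) \<Rightarrow> 'a" where
  "dt n T = det (mat n n (\<lambda>(i, j). T i j))"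

lemma dt_0 [simp]: "dt 0 T = 1"
  by (simp add: dt_def)

lemma dt_1 [simp]: "dt (Suc 0) T = T 0 0"
  by (simp add: dt_def det_single)

lemma dt_2:
  fixes T :: "nat \<Rightarrow> nat \<Rightarrow> 'a::idom"
  shows "dt 2 T = T 0 0 * T 1 1 - T 0 1 * T 1 0"
proof -
  \<comment> \<open>Entries are read as 1 by 1 blocks, which commute as the block determinant
    formula requires.\<close>
  define m where "m = mat 1 1 \<circ> (\<lambda>c _. c :: 'a)"
  have m: "m c \<in> carrier_mat 1 1" "m c $$ (0, 0) = c" "det (m c) = c" for c
    by (auto simp: m_def det_single)
  have mm: "m c * m d = m (c * d)" "m c - m d = m (c - d)" for c d
    by (rule eq_matI; auto simp: m_def scalar_prod_def)+
  have "mat 2 2 (\<lambda>(i, j). T i j) = four_block_mat (m (T 0 0)) (m (T 0 1)) (m (T 1 0)) (m (T 1 1))"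
    by (rule eq_matI) (auto simp: m_def less_Suc_eq)
  also have "det \<dots> = det (m (T 0 0) * m (T 1 1) - m (T 0 1) * m (T 1 0))"
    by (rule det_four_block_mat) (use m in \<open>auto simp: mm mult.commute\<close>)
  also have "\<dots> = T 0 0 * T 1 1 - T 0 1 * T 1 0" by (simp only: mm m)
  finally show ?thesis by (simp add: dt_def)
qed

text \<open>The permutation acts on rows and on columns, so its sign enters squared. This allows
  pivots to be moved to the front.\<close>

lemma dt_permute:
  fixes T :: "nat \<Rightarrow> nat \<Rightarrow> 'a::field"
  assumes p: "p permutes {..<n}"
  shows "dt n (\<lambda>i j. T (p i) (p j)) = dt n T"
proof -
  have p': "p permutes {0..<n}" using p by (simp add: atLeast0LessThan)
  have lt: "p i < n" if "i < n" for i using permutes_in_image[OF p, of i] that by simp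
  let ?A = "mat n n (\<lambda>(i, j). T i (p j))" and ?B = "mat n n (\<lambda>(i, j). T i j)"
  have "mat n n (\<lambda>(i, j). ?A $$ (p i, j)) = mat n n (\<lambda>(i, j). T (p i) (p j))"
    by (rule cong_mat) (auto simp: lt)
  with det_permute_rows[of ?A n p] p' have 1: "dt n (\<lambda>i j. T (p i) (p j)) = signof p * det ?A"
    by (simp add: dt_def)
  have "mat n n (\<lambda>(i, j). transpose_mat ?B $$ (p i, j)) = transpose_mat ?A"
    by (rule eq_matI) (auto simp: lt)
  with det_permute_rows[of "transpose_mat ?B" n p] p' 
  have "det (transpose_mat ?A) = signof p * det (transpose_mat ?B)"
    by simp
  then have 2: "det ?A = signof p * det ?B" by (simp add: det_transpose[of ?A n] det_transpose[of ?B n])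
  have "signof p * signof p = (1::'a)" by (simp add: sign_def)
  with 1 2 show ?thesis by (simp add: dt_def flip: mult.assoc)
qed

lemma exists_permutes_two:
  assumes "i < n" "j < n" "i \<noteq> j"
  shows "\<exists>p. p permutes {..<n} \<and> p 0 = i \<and> p 1 = (j::nat)"
proof -
  let ?p = "transpose 0 i"
  \<comment> \<open>The second swap sends 1 to the preimage of \<open>j\<close> under the first.
    That preimage is not 0, as \<open>i \<noteq> j\<close>, so 0 still goes to
    \<open>i\<close>.\<close>
  let ?q = "transpose 1 (?p j)"
  have "1 < n" using assms by linarith
  have "?p j < n" using assms by (auto simp: transpose_def)
  then have "?p \<circ> ?q permutes {..<n}"
    using assms \<open>1 < n\<close> by (intro permutes_compose permutes_swap_id) auto
  moreover have "(?p \<circ> ?q) 0 = i" "(?p \<circ> ?q) 1 = j"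
    using assms by (auto simp: transpose_def)
  ultimately show ?thesis by (intro exI[of _ "?p \<circ> ?q"] conjI)
qed

text \<open>The Schur complement of the leading block of size \<open>k\<close>. The inverse of that
  block is the argument \<open>V\<close>, so that weight bounds can be imposed on it.\<close>

definition schur :: "nat \<Rightarrow> (nat \<Rightarrow> nat \<Rightarrow> 'a::field) \<Rightarrow> (nat \<Rightarrow> nat \<Rightarrow> 'a) \<Rightarrow> nat \<Rightarrow> nat \<Rightarrow> 'a" where
  "schur k V T i j = T (k + i) (k + j) - bil k V (\<lambda>p. T (k + i) p) (\<lambda>q. T q (k + j))"

text \<open>Multiplication by the unipotent block matrix \<open>?W\<close> clears the upper right
  block and leaves the Schur complement in the lower right one.\<close>

lemma dt_schur:
  fixes T :: "nat \<Rightarrow> nat \<Rightarrow> 'a::field"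
  assumes V: "\<And>i j. i < k \<Longrightarrow> j < k \<Longrightarrow> (\<Sum>l<k. T i l * V l j) = (if i = j then 1 else 0)"
  shows "dt (k + m) T = dt k T * dt m (schur k V T)"
proof -
  let ?P = "mat k k (\<lambda>(i, j). T i j)" and ?R = "mat k m (\<lambda>(i, j). T i (k + j))"
  let ?L = "mat m k (\<lambda>(i, j). T (k + i) j)" and ?Q = "mat m m (\<lambda>(i, j). T (k + i) (k + j))"
  let ?X = "mat k m (\<lambda>(i, j). - (\<Sum>q<k. V i q * T q (k + j)))"
  have M: "mat (k + m) (k + m) (\<lambda>(i, j). T i j) = four_block_mat ?P ?R ?L ?Q"
    by (rule eq_matI) auto
  let ?W = "four_block_mat (1\<^sub>m k) ?X (0\<^sub>m m k) (1\<^sub>m m)"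
  have PX: "?P * ?X + ?R = 0\<^sub>m k m"
  proof (rule eq_matI)
    fix i j assume "i < dim_row (0\<^sub>m k m :: 'a mat)" "j < dim_col (0\<^sub>m k m :: 'a mat)"
    then have ij: "i < k" "j < m" by auto
    have "(\<Sum>l<k. T i l * (\<Sum>q<k. V l q * T q (k + j))) = (\<Sum>q<k. (\<Sum>l<k. T i l * V l q) * T q (k + j))"
      unfolding sum_distrib_left sum_distrib_right by (subst sum.swap) (simp add: mult_ac)
    also have "\<dots> = (\<Sum>q<k. if i = q then T q (k + j) else 0)"
      by (rule sum.cong) (auto simp: V ij)
    also have "\<dots> = T i (k + j)" using ij by simp
    finally show "(?P * ?X + ?R) $$ (i, j) = 0\<^sub>m k m $$ (i, j)"
      using ij by (simp add: scalar_prod_def atLeast0LessThan sum_negf)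
  qed auto
  have LX: "?L * ?X + ?Q = mat m m (\<lambda>(i, j). schur k V T i j)"
  proof (rule eq_matI)
    fix i j assume "i < dim_row (mat m m (\<lambda>(i, j). schur k V T i j))"
      "j < dim_col (mat m m (\<lambda>(i, j). schur k V T i j))"
    then have ij: "i < m" "j < m" by auto
    then show "(?L * ?X + ?Q) $$ (i, j) = mat m m (\<lambda>(i, j). schur k V T i j) $$ (i, j)"
      by (simp add: scalar_prod_def atLeast0LessThan sum_negf schur_def bil_eq)
  qed auto
  have "four_block_mat ?P ?R ?L ?Q * ?W
      = four_block_mat (?P * 1\<^sub>m k + ?R * 0\<^sub>m m k) (?P * ?X + ?R * 1\<^sub>m m)
          (?L * 1\<^sub>m k + ?Q * 0\<^sub>m m k) (?L * ?X + ?Q * 1\<^sub>m m)"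
    by (rule mult_four_block_mat[of _ k k _ m _ m]) auto
  also have "\<dots> = four_block_mat ?P (0\<^sub>m k m) ?L (mat m m (\<lambda>(i, j). schur k V T i j))"
    using PX LX by (simp add: right_mult_one_mat[of _ _ m] right_mult_zero_mat[of _ _ m])
  finally have "det (four_block_mat ?P ?R ?L ?Q * ?W)
      = det ?P * det (mat m m (\<lambda>(i, j). schur k V T i j))"
    by (simp add: det_four_block_mat_upper_right_zero[of _ k _ m])
  moreover have "det ?W = 1"
    by (subst det_four_block_mat_lower_left_zero[of _ k _ m]) auto
  moreover have "det (four_block_mat ?P ?R ?L ?Q * ?W) = det (four_block_mat ?P ?R ?L ?Q) * det ?W"
    by (rule det_mult[of _ "k + m"]) auto
  ultimately show ?thesis unfolding dt_def M by simp
qed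

text \<open>
  \<open>T\<close> plays the role of \<open>2 B\<close>, so that the quadratic form is \<open>bil n T x x / 2\<close>. The weights may be
  negative, since the inverse of a pivot block has the negated weights.
\<close>

definition half_form :: "('a::field_char_0 \<Rightarrow> ereal) \<Rightarrow> nat \<Rightarrow> (nat \<Rightarrow> int) \<Rightarrow> (nat \<Rightarrow> nat \<Rightarrow> 'a) \<Rightarrow> bool" where
  "half_form ord n a T \<longleftrightarrow> (\<forall>i<n. \<forall>j<n. T i j = T j i) \<and>
     (\<forall>i<n. ereal (of_int (a i)) \<le> ord (T i i / 2)) \<and>
     (\<forall>i<n. \<forall>j<n. ereal ((of_int (a i) + of_int (a j)) / 2) \<le> ord (T i j))"

definition norm_ge :: "('a::field_char_0 \<Rightarrow> ereal) \<Rightarrow> nat \<Rightarrow> (nat \<Rightarrow> int) \<Rightarrow> real \<Rightarrow> (nat \<Rightarrow> 'a) \<Rightarrow> bool" where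
  "norm_ge ord n a r x \<longleftrightarrow> (\<forall>i<n. ereal (r - of_int (a i) / 2) \<le> ord (x i))"

text \<open>The second condition makes \<open>r\<close> the exact norm of \<open>x\<close>. The last
  two demand strictness where \<open>quad_ge\<close> and \<open>row_ge\<close> give a weak bound in
  general: the form at \<open>x\<close> and the pairings with all basis vectors vanish in their
  lowest possible degree.\<close>

definition defective :: "('a::field_char_0 \<Rightarrow> ereal) \<Rightarrow> nat \<Rightarrow> (nat \<Rightarrow> int) \<Rightarrow> (nat \<Rightarrow> nat \<Rightarrow> 'a) \<Rightarrow> bool" where
  "defective ord n a T \<longleftrightarrow> (\<exists>r x. norm_ge ord n a r x \<and>
     (\<exists>i<n. ord (x i) = ereal (r - of_int (a i) / 2)) \<and>
     ereal (2 * r) < ord (bil n T x x / 2) \<and>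
     (\<forall>i<n. ereal (r + of_int (a i) / 2) < ord (\<Sum>j<n. T i j * x j)))"

lemma half_form_sym: "half_form ord n a T \<Longrightarrow> i < n \<Longrightarrow> j < n \<Longrightarrow> T i j = T j i"
  by (simp add: half_form_def)

lemma half_form_diag: "half_form ord n a T \<Longrightarrow> i < n \<Longrightarrow> ereal (of_int (a i)) \<le> ord (T i i / 2)"
  by (simp add: half_form_def)

lemma half_form_entry:
  "half_form ord n a T \<Longrightarrow> i < n \<Longrightarrow> j < n \<Longrightarrow> ereal ((of_int (a i) + of_int (a j)) / 2) \<le> ord (T i j)"
  by (simp add: half_form_def)

lemma half_form_permute:
  assumes "p permutes {..<n}" "half_form ord n a T"
  shows "half_form ord n (\<lambda>i. a (p i)) (\<lambda>i j. T (p i) (p j))"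
proof -
  have lt: "p i < n" if "i < n" for i using permutes_in_image[OF assms(1), of i] that by simp
  show ?thesis using assms(2) lt by (simp add: half_form_def)
qed

lemma defective_permute:
  assumes p: "p permutes {..<n}" and d: "defective ord n (\<lambda>i. a (p i)) (\<lambda>i j. T (p i) (p j))"
  shows "defective ord n a T"
proof -
  define q where "q = inv_into UNIV p"
  have pq: "p (q i) = i" and qp: "q (p i) = i" for i
    using permutes_inverses[OF p] by (auto simp: q_def)
  have lt: "p i < n \<longleftrightarrow> i < n" for i using permutes_in_image[OF p, of i] by simp
  have ltq: "q i < n \<longleftrightarrow> i < n" for i using lt[of "q i"] by (simp add: pq)
  obtain r x where x: "norm_ge ord n (\<lambda>i. a (p i)) r x"
    "\<exists>i<n. ord (x i) = ereal (r - of_int (a (p i)) / 2)"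
    "ereal (2 * r) < ord (bil n (\<lambda>i j. T (p i) (p j)) x x / 2)"
    "\<And>i. i < n \<Longrightarrow> ereal (r + of_int (a (p i)) / 2) < ord (\<Sum>j<n. T (p i) (p j) * x j)"
    using d unfolding defective_def by blast
  have sum: "(\<Sum>j<n. f (p j)) = (\<Sum>j<n. f j)" for f :: "nat \<Rightarrow> 'a"
    using sum.permute[OF p, of f] by (simp add: o_def)
  have row: "(\<Sum>j<n. T (p i) (p j) * x j) = (\<Sum>j<n. T (p i) j * x (q j))" for i
    using sum[of "\<lambda>j. T (p i) j * x (q j)"] by (simp add: qp)
  have bil: "bil n (\<lambda>i j. T (p i) (p j)) x x = bil n T (x \<circ> q) (x \<circ> q)"
    unfolding bil_eq row using sum[of "\<lambda>i. x (q i) * (\<Sum>j<n. T i j * x (q j))"] by (simp add: qp)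
  obtain i where i: "i < n" "ord (x i) = ereal (r - of_int (a (p i)) / 2)" using x(2) by blast
  show ?thesis unfolding defective_def
  proof (intro exI conjI allI impI)
    show "norm_ge ord n a r (x \<circ> q)"
      using x(1) unfolding norm_ge_def by (metis comp_apply ltq pq)
    show "p i < n" "ord ((x \<circ> q) (p i)) = ereal (r - of_int (a (p i)) / 2)" using i by (auto simp: lt qp)
    show "ereal (2 * r) < ord (bil n T (x \<circ> q) (x \<circ> q) / 2)" using x(3) by (simp add: bil)
    fix i assume "i < n"
    then show "ereal (r + of_int (a i) / 2) < ord (\<Sum>j<n. T i j * (x \<circ> q) j)"
      using x(4)[of "q i"] unfolding row by (simp add: pq ltq)
  qed
qed

section \<open>Weight bounds and their passage to Schur complements\<close>

context nonarch_local_field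
begin

lemma bil_ge:
  assumes T: "half_form ord n a T" and x: "norm_ge ord n a r x" and y: "norm_ge ord n a s y"
  shows "ereal (r + s) \<le> ord (bil n T x y)"
  unfolding bil_def
proof (intro ord_sum_ge)
  fix i j assume ij: "i \<in> {..<n}" "j \<in> {..<n}"
  have "ereal ((r - of_int (a i) / 2) + (of_int (a i) + of_int (a j)) / 2 + (s - of_int (a j) / 2))
      \<le> ord (x i * T i j * y j)"
    using T x y ij unfolding half_form_def norm_ge_def by (intro ord_mult_ge) auto
  then show "ereal (r + s) \<le> ord (x i * T i j * y j)"
      by (rule ereal_le_weaken) (simp add: add_divide_distrib)
qed

lemma half_form_mono: "half_form ord (Suc n) a T \<Longrightarrow> half_form ord n a T"
  by (simp add: half_form_def)

text \<open>The sum may be shorter than the rows of the matrix, because the induction in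
  \<open>quad_ge\<close> pairs row \<open>n\<close> with the first \<open>n\<close>
  coordinates.\<close>

lemma row_ge:
  assumes T: "half_form ord n a T" and x: "norm_ge ord m a r x" and "i < n" "m \<le> n"
  shows "ereal (r + of_int (a i) / 2) \<le> ord (\<Sum>j<m. T i j * x j)"
proof (intro ord_sum_ge)
  fix j assume j: "j \<in> {..<m}"
  have "ereal ((of_int (a i) + of_int (a j)) / 2 + (r - of_int (a j) / 2)) \<le> ord (T i j * x j)"
    using assms j unfolding half_form_def norm_ge_def by (intro ord_mult_ge) auto
  then show "ereal (r + of_int (a i) / 2) \<le> ord (T i j * x j)"
      by (rule ereal_le_weaken) (simp add: add_divide_distrib)
qed

text \<open>This does not follow from \<open>bil_ge\<close>, since halving may lower the valuation.
  Off-diagonal products occur twice in the double sum, so the division by 2 only reaches the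
  diagonal entries, whose halves are bounded.\<close>

lemma quad_ge:
  assumes "half_form ord n a T" "norm_ge ord n a r x"
  shows "ereal (2 * r) \<le> ord (bil n T x x / 2)"
  using assms
proof (induction n)
  case 0
  then show ?case by (simp add: bil_def)
next
  case (Suc n)
  have x: "norm_ge ord n a r x" "ereal (r - of_int (a n) / 2) \<le> ord (x n)"
    using Suc.prems by (auto simp: norm_ge_def)
  have eq: "bil (Suc n) T x x / 2
      = bil n T x x / 2 + x n * (\<Sum>j<n. T n j * x j) + x n * (T n n / 2) * x n"
    using half_form_sym[OF Suc.prems(1)] by (subst bil_Suc) (auto simp: field_simps)
  have 1: "ereal ((r - of_int (a n) / 2) + (r + of_int (a n) / 2)) \<le> ord (x n * (\<Sum>j<n. T n j * x j))"
    by (intro ord_mult_ge x row_ge[OF Suc.prems(1)]) auto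
  have 2: "ereal ((r - of_int (a n) / 2) + of_int (a n) + (r - of_int (a n) / 2)) \<le> ord (x n * (T n n / 2) * x n)"
    by (intro ord_mult_ge x half_form_diag[OF Suc.prems(1)]) auto
  show ?case unfolding eq
    using Suc.IH[OF half_form_mono[OF Suc.prems(1)] x(1)] 1 2 by (intro ord_add_ge) auto
qed

text \<open>Row \<open>k + i\<close> of the off-diagonal block has norm at least
  \<open>a (k + i) / 2\<close> for the negated weights, which are those of \<open>V\<close>. Hence
  the correction term obeys the bounds of \<open>T\<close>, and by \<open>quad_ge\<close> its
  diagonal does so after halving.\<close>

lemma schur_half_form:
  assumes T: "half_form ord (k + m) a T" and V: "half_form ord k (\<lambda>i. - a i) V"
  shows "half_form ord m (\<lambda>i. a (k + i)) (schur k V T)"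
proof -
  have col: "(\<lambda>q. T q (k + j)) p = (\<lambda>q. T (k + j) q) p" if "j < m" "p < k" for j p
    using half_form_sym[OF T, of p "k + j"] that by simp
  have eq: "schur k V T i j = T (k + i) (k + j) - bil k V (\<lambda>p. T (k + i) p) (\<lambda>q. T (k + j) q)"
    if "j < m" for i j
    unfolding schur_def bil_def using col[OF that] by simp
  have wt: "norm_ge ord k (\<lambda>i. - a i) (of_int (a (k + i)) / 2) (\<lambda>p. T (k + i) p)" if "i < m" for i
    unfolding norm_ge_def
  proof (intro allI impI)
    fix p assume "p < k"
    then have "ereal ((of_int (a (k + i)) + of_int (a p)) / 2) \<le> ord (T (k + i) p)"
      using half_form_entry[OF T, of "k + i" p] that by simp
    then show "ereal (of_int (a (k + i)) / 2 - of_int (- a p) / 2) \<le> ord (T (k + i) p)"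
      by (rule ereal_le_weaken) (simp add: add_divide_distrib)
  qed
  have bsym: "bil k V x y = bil k V y x" for x y
    unfolding bil_def by (subst sum.swap) (auto intro!: sum.cong simp: half_form_sym[OF V] mult_ac)
  show ?thesis unfolding half_form_def
  proof (intro conjI allI impI)
    fix i j assume ij: "i < m" "j < m"
    show "schur k V T i j = schur k V T j i"
      unfolding eq[OF ij(1)] eq[OF ij(2)] using half_form_sym[OF T, of "k + i" "k + j"] ij
      by (subst bsym) simp
    have "ereal (of_int (a (k + i)) / 2 + of_int (a (k + j)) / 2)
        \<le> ord (bil k V (\<lambda>p. T (k + i) p) (\<lambda>q. T (k + j) q))"
      by (rule bil_ge[OF V wt wt]) (use ij in auto)
    then show "ereal ((of_int (a (k + i)) + of_int (a (k + j))) / 2) \<le> ord (schur k V T i j)"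
      unfolding eq[OF ij(2)] using half_form_entry[OF T, of "k + i" "k + j"] ij
      by (intro ord_diff_ge) (auto simp: add_divide_distrib)
  next
    fix i assume i: "i < m"
    have "ereal (2 * (of_int (a (k + i)) / 2))
        \<le> ord (bil k V (\<lambda>p. T (k + i) p) (\<lambda>q. T (k + i) q) / 2)"
      by (rule quad_ge[OF V wt]) (use i in auto)
    then show "ereal (of_int (a (k + i))) \<le> ord (schur k V T i i / 2)"
      unfolding eq[OF i] diff_divide_distrib using half_form_diag[OF T, of "k + i"] i
      by (intro ord_diff_ge) auto
  qed
qed

text \<open>A defect vector is lifted to the vector above it that pairs to zero with the pivot
  block. On the lift, the form and the remaining rows agree with those of the Schur complement, and
  the bounds on \<open>V\<close> keep the new coordinates within the norm \<open>r\<close>.\<close>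

lemma schur_defective:
  assumes T: "half_form ord (k + m) a T" and V: "half_form ord k (\<lambda>i. - a i) V"
    and inv: "\<And>i j. i < k \<Longrightarrow> j < k \<Longrightarrow> (\<Sum>l<k. T i l * V l j) = (if i = j then 1 else 0)"
    and d: "defective ord m (\<lambda>i. a (k + i)) (schur k V T)"
  shows "defective ord (k + m) a T"
proof -
  obtain r z where z: "norm_ge ord m (\<lambda>i. a (k + i)) r z"
    "\<exists>i<m. ord (z i) = ereal (r - of_int (a (k + i)) / 2)"
    "ereal (2 * r) < ord (bil m (schur k V T) z z / 2)"
    "\<And>i. i < m \<Longrightarrow> ereal (r + of_int (a (k + i)) / 2) < ord (\<Sum>j<m. schur k V T i j * z j)"
    using d unfolding defective_def by blast
  define c where "c q = (\<Sum>j<m. T q (k + j) * z j)" for q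
  define x where "x i = (if i < k then - (\<Sum>q<k. V i q * c q) else z (i - k))" for i
  have c: "ereal (r + of_int (a q) / 2) \<le> ord (c q)" if "q < k" for q
    unfolding c_def
  proof (intro ord_sum_ge)
    fix j assume j: "j \<in> {..<m}"
    have "ereal ((of_int (a q) + of_int (a (k + j))) / 2 + (r - of_int (a (k + j)) / 2))
        \<le> ord (T q (k + j) * z j)"
      using half_form_entry[OF T, of q "k + j"] z(1) j that unfolding norm_ge_def
      by (intro ord_mult_ge) auto
    then show "ereal (r + of_int (a q) / 2) \<le> ord (T q (k + j) * z j)"
      by (rule ereal_le_weaken) (simp add: add_divide_distrib)
  qed
  have wt: "norm_ge ord (k + m) a r x" unfolding norm_ge_def
  proof (intro allI impI)
    fix i assume i: "i < k + m"
    show "ereal (r - of_int (a i) / 2) \<le> ord (x i)"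
    proof (cases "i < k")
      case True
      have "ereal (r - of_int (a i) / 2) \<le> ord (V i q * c q)" if "q < k" for q
      proof -
        have "ereal ((of_int (- a i) + of_int (- a q)) / 2 + (r + of_int (a q) / 2)) \<le> ord (V i q * c q)"
          using half_form_entry[OF V True that] c[OF that] by (intro ord_mult_ge) auto
        then show ?thesis by (rule ereal_le_weaken) (simp add: add_divide_distrib diff_divide_distrib)
      qed
      then have "ereal (r - of_int (a i) / 2) \<le> ord (\<Sum>q<k. V i q * c q)"
        by (intro ord_sum_ge) simp
      then show ?thesis using True by (simp add: x_def)
    next
      case False
      then obtain i' where "i = k + i'" "i' < m"
        using i by (metis add_diff_inverse_nat nat_add_left_cancel_less)
      then show ?thesis using z(1) by (simp add: norm_ge_def x_def)
    qed
  qed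
  have Tx: "(\<Sum>j<k. T i j * x j) = - (\<Sum>q<k. (\<Sum>j<k. T i j * V j q) * c q)" for i
  proof -
    have "(\<Sum>j<k. T i j * x j) = - (\<Sum>j<k. \<Sum>q<k. T i j * V j q * c q)"
      by (simp add: x_def sum_negf sum_distrib_left mult.assoc)
    also have "\<dots> = - (\<Sum>q<k. \<Sum>j<k. T i j * V j q * c q)" by (subst sum.swap) simp
    finally show ?thesis by (simp add: sum_distrib_right)
  qed
  have split: "(\<Sum>j<k + m. T i j * x j) = (\<Sum>j<k. T i j * x j) + c i" for i
    unfolding sum_lessThan_add by (simp add: x_def c_def)
  have row1: "(\<Sum>j<k + m. T i j * x j) = 0" if i: "i < k" for i
  proof -
    have "(\<Sum>q<k. (\<Sum>j<k. T i j * V j q) * c q) = (\<Sum>q<k. if i = q then c q else 0)"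
      by (rule sum.cong) (auto simp: inv i)
    then show ?thesis unfolding split Tx using i by simp
  qed
  have row2: "(\<Sum>j<k + m. T (k + i) j * x j) = (\<Sum>j<m. schur k V T i j * z j)" for i
  proof -
    have "(\<Sum>j<m. bil k V (\<lambda>p. T (k + i) p) (\<lambda>q. T q (k + j)) * z j)
        = (\<Sum>j<m. \<Sum>q<k. (\<Sum>p<k. T (k + i) p * V p q) * (T q (k + j) * z j))"
      unfolding bil_def by (subst sum.swap) (simp add: sum_distrib_right mult.assoc)
    also have "\<dots> = (\<Sum>q<k. (\<Sum>p<k. T (k + i) p * V p q) * c q)"
      by (subst sum.swap) (simp add: c_def sum_distrib_left)
    finally show ?thesis unfolding split Tx
      by (simp add: schur_def left_diff_distrib sum_subtractf c_def)
  qed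
  have "bil (k + m) T x x = (\<Sum>i<k. x i * (\<Sum>j<k + m. T i j * x j))
      + (\<Sum>i<m. x (k + i) * (\<Sum>j<k + m. T (k + i) j * x j))"
    unfolding bil_eq by (rule sum_lessThan_add)
  then have bil: "bil (k + m) T x x = bil m (schur k V T) z z"
    by (simp add: row1 row2 bil_eq) (simp add: x_def)
  obtain i where i: "i < m" "ord (z i) = ereal (r - of_int (a (k + i)) / 2)" using z(2) by blast
  show ?thesis unfolding defective_def
  proof (intro exI conjI allI impI)
    show "norm_ge ord (k + m) a r x" by (rule wt)
    show "k + i < k + m" "ord (x (k + i)) = ereal (r - of_int (a (k + i)) / 2)"
      using i by (auto simp: x_def)
    show "ereal (2 * r) < ord (bil (k + m) T x x / 2)" unfolding bil by (rule z(3))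
    fix i assume i: "i < k + m"
    show "ereal (r + of_int (a i) / 2) < ord (\<Sum>j<k + m. T i j * x j)"
    proof (cases "i < k")
      case True
      then show ?thesis by (simp add: row1)
    next
      case False
      then show ?thesis using z(4)[of "i - k"] row2[of "i - k"] i by simp
    qed
  qed
qed

end

section \<open>Discriminants of nondefective forms\<close>

text \<open>\<open>k\<close> is the value of \<Delta> attached to \<open>D\<close> in even rank. In
  the Eisenstein case the valuation of \<open>s\<^sup>2 - 4 * w\<close> stays free, because \<Delta>
  subtracts it.\<close>

definition disc_form :: "('a::field_char_0 \<Rightarrow> ereal) \<Rightarrow> 'a \<Rightarrow> int \<Rightarrow> bool" where
  "disc_form ord D k \<longleftrightarrow> (\<exists>y s w. y \<noteq> 0 \<and> D = y\<^sup>2 * (s\<^sup>2 - 4 * w) \<and>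
     (unit_disc ord s w \<and> ord y + ord y = ereal (of_int k) \<or>
      eisenstein ord s w \<and> ord y + ord y + 1 = ereal (of_int k)))"

context nonarch_local_field
begin

text \<open>In the Eisenstein case the discriminant contributes
  \<open>ord (s\<^sup>2 - 4 * w)\<close>, which cancels, and the summand 1 remains. In the unit case
  the ideal is the whole ring and the 1 is cancelled, for a square \<open>D\<close> as well as for
  an unramified extension.\<close>

lemma disc_form_invariant:
  assumes "D \<noteq> 0" "disc_form ord D k"
  shows "ord D - ereal (ord_ideal ord (disc_ideal ord D)) + 1
    - (if nonzero_square D \<or> unramified_quad ord D then 1 else 0) = ereal (of_int k)"
proof -
  obtain y s w where y: "y \<noteq> 0" and D: "D = y\<^sup>2 * (s\<^sup>2 - 4 * w)"
    and sw: "unit_disc ord s w \<and> ord y + ord y = ereal (of_int k) \<or>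
      eisenstein ord s w \<and> ord y + ord y + 1 = ereal (of_int k)"
    using assms(2) unfolding disc_form_def by blast
  let ?d = "s\<^sup>2 - 4 * w"
  have dne: "?d \<noteq> 0" using D assms(1) by auto
  have ordD: "ord D = ord y + ord y + ord ?d" by (simp add: D ord_mult ord_power2)
  from sw show ?thesis
  proof (elim disjE conjE)
    assume U: "unit_disc ord s w" and k: "ord y + ord y = ereal (of_int k)"
    have d0: "ord ?d = ereal (real 0)" using U by (simp add: unit_disc_def zero_ereal_def)
    have ideal: "disc_ideal ord D = {x. ereal (real 0) \<le> ord x}"
    proof (cases "nonzero_square D")
      case True
      then show ?thesis by (simp add: disc_ideal_def val_ring_def zero_ereal_def)
    next
      case False
      then show ?thesis using disc_ideal_theta[OF False assms(1) D y] U d0 by simp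
    qed
    have "nonzero_square D \<or> unramified_quad ord D"
      using unit_disc_unramified[OF _ assms(1) D y U] by blast
    then show ?thesis
      unfolding ideal ord_ideal_eq ordD d0 k by (simp add: one_ereal_def)
  next
    assume R: "eisenstein ord s w" and k: "ord y + ord y + 1 = ereal (of_int k)"
    have ns: "\<not> nonzero_square D" by (rule eisenstein_not_square[OF assms(1) D y R])
    have nr: "\<not> unramified_quad ord D" by (rule eisenstein_ramified[OF ns assms(1) D y R])
    have "0 \<le> ord ?d" using R unfolding eisenstein_def power2_eq_square
      by (intro ord_diff_ge ord_mult_ge0) (auto intro: one_le_imp_zero_le_ereal)
    moreover obtain m :: int where m: "ord ?d = ereal (of_int m)" using ord_nonzeroE[OF dne] by blast
    ultimately have d: "ord ?d = ereal (real (nat m))" by simp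
    have ideal: "disc_ideal ord D = {x. ereal (real (nat m)) \<le> ord x}"
      using disc_ideal_theta[OF ns assms(1) D y] R d by simp
    show ?thesis
      unfolding ideal ord_ideal_eq ordD d using ns nr k by (cases "ord y") (auto simp: one_ereal_def)
  qed
qed

text \<open>With 4 a unit, the square can be completed. For even \<open>k\<close> one removes a
  square to reach a unit \<open>u\<close> and takes \<open>s = 1\<close>; for odd \<open>k\<close>
  one takes \<open>s = 0\<close>, and \<open>w\<close> is a prime element.\<close>

lemma disc_form_odd_residue:
  assumes "ord 2 = 0" "ord D = ereal (of_int k)"
  shows "disc_form ord D k"
proof -
  have o4: "ord 4 = ereal 0" using assms(1) by (simp add: ord_4 zero_ereal_def)
  show ?thesis
  proof (cases "even k")
    case True
    then obtain l where l: "k = 2 * l" by (elim evenE)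
    obtain y where y: "y \<noteq> 0" "ord y = ereal (of_int l)" using ord_exists by blast
    define u where "u = D / y\<^sup>2"
    have u: "ord u = 0"
      using assms(2) y ord_divide[of "y\<^sup>2" "of_int k" D] by (simp add: u_def ord_power2 l zero_ereal_def)
    have quarter: "1\<^sup>2 - 4 * ((1 - u) / 4) = u" by (simp add: diff_divide_distrib right_diff_distrib)
    have D: "D = y\<^sup>2 * (1\<^sup>2 - 4 * ((1 - u) / 4))" unfolding quarter using y by (simp add: u_def)
    have "0 \<le> ord ((1 - u) / 4)"
      using ord_divide[OF o4, of "1 - u"] u ord_diff_ge[of 0 1 u] by (simp flip: zero_ereal_def)
    then have "unit_disc ord 1 ((1 - u) / 4)" unfolding unit_disc_def quarter using u by simp
    then show ?thesis using y D l unfolding disc_form_def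
      by (intro exI[of _ y] exI[of _ 1] exI[of _ "(1 - u) / 4"]) auto
  next
    case False
    then obtain l where l: "k = 2 * l + 1" by (elim oddE)
    obtain y where y: "y \<noteq> 0" "ord y = ereal (of_int l)" using ord_exists by blast
    define w where "w = - (D / y\<^sup>2) / 4"
    have D: "D = y\<^sup>2 * (0\<^sup>2 - 4 * w)" using y by (simp add: w_def)
    have "ord (D / y\<^sup>2) = 1"
      using assms(2) y ord_divide[of "y\<^sup>2" "of_int (2 * l)" D] by (simp add: ord_power2 l one_ereal_def)
    then have "ord w = 1"
      unfolding w_def ord_divide[OF o4] ord_minus by (simp flip: zero_ereal_def)
    then have "eisenstein ord 0 w" by (simp add: eisenstein_def)
    then show ?thesis using y D l unfolding disc_form_def
      by (intro exI[of _ y] exI[of _ 0] exI[of _ w]) (auto simp: one_ereal_def)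
  qed
qed

lemma ord_1_minus_4:
  assumes "0 < ord 2" "0 \<le> ord w"
  shows "ord (1 - 4 * w) = 0"
proof -
  have "1 \<le> ord 2" by (rule ord_gt_0[OF assms(1)])
  then have "0 < ord (4 * w)" using assms by (cases "ord w"; cases "ord 2") (auto simp: ord_mult ord_4 one_ereal_def)
  then show ?thesis using ord_add_eq[of 1 "- (4 * w)"] by simp
qed

text \<open>The factor \<open>1 - 4 * v\<close> is absorbed by adding
  \<open>v * (s\<^sup>2 - 4 * w)\<close> to \<open>w\<close>, with \<open>s\<close> unchanged. In
  the Eisenstein case this correction has valuation at least 2, so \<open>w\<close> keeps valuation
  1 and the type persists.\<close>

lemma disc_form_mult:
  assumes "0 < ord 2" "disc_form ord D k" "ord t = ereal (of_int h)" "0 \<le> ord v"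
  shows "disc_form ord (t\<^sup>2 * (1 - 4 * v) * D) (k + 2 * h)"
proof -
  obtain y s w where y: "y \<noteq> 0" and D: "D = y\<^sup>2 * (s\<^sup>2 - 4 * w)"
    and sw: "unit_disc ord s w \<and> ord y + ord y = ereal (of_int k) \<or>
      eisenstein ord s w \<and> ord y + ord y + 1 = ereal (of_int k)"
    using assms(2) unfolding disc_form_def by blast
  define w' where "w' = w + v * (s\<^sup>2 - 4 * w)"
  have d: "(1 - 4 * v) * (s\<^sup>2 - 4 * w) = s\<^sup>2 - 4 * w'" by (simp add: w'_def algebra_simps)
  then have D': "t\<^sup>2 * (1 - 4 * v) * D = (t * y)\<^sup>2 * (s\<^sup>2 - 4 * w')"
    unfolding D d[symmetric] by (simp add: power_mult_distrib)
  have ty: "t * y \<noteq> 0" using y assms(3) by auto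
  have ordty: "ord (t * y) + ord (t * y) = ord y + ord y + ereal (of_int (2 * h))"
    using assms(3) by (cases "ord y") (auto simp: ord_mult)
  from sw show ?thesis
  proof (elim disjE conjE)
    assume U: "unit_disc ord s w" and k: "ord y + ord y = ereal (of_int k)"
    then have "ord (s\<^sup>2 - 4 * w') = 0"
      unfolding d[symmetric] by (simp add: ord_mult ord_1_minus_4 assms unit_disc_def)
    moreover have "0 \<le> ord w'"
      using U assms(4) unfolding w'_def unit_disc_def by (intro ord_add_ge ord_mult_ge0) auto
    ultimately have "unit_disc ord s w'" using U by (auto simp: unit_disc_def)
    moreover have "ord (t * y) + ord (t * y) = ereal (of_int (k + 2 * h))"
      unfolding ordty k by simp
    ultimately show ?thesis unfolding disc_form_def using D' ty by blast
  next
    assume R: "eisenstein ord s w" and k: "ord y + ord y + 1 = ereal (of_int k)"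
    then have s: "ereal 1 \<le> ord s" and w: "ereal 1 \<le> ord w" "ord w = ereal 1"
      by (auto simp: eisenstein_def one_ereal_def)
    have "ereal (1 + 1) \<le> ord (s\<^sup>2)" unfolding power2_eq_square by (intro ord_mult_ge s)
    moreover have "ereal (1 + 1) \<le> ord (4 * w)"
      by (intro ord_mult_ge w) (use ord_gt_0[OF assms(1)] in \<open>cases "ord 2", auto simp: ord_4 one_ereal_def\<close>)
    ultimately have "ereal 2 \<le> ord (s\<^sup>2 - 4 * w)" by (intro ord_diff_ge) auto
    then have "ereal (0 + 2) \<le> ord (v * (s\<^sup>2 - 4 * w))"
      using assms(4) by (intro ord_mult_ge) (auto simp flip: zero_ereal_def)
    then have "ord w < ord (v * (s\<^sup>2 - 4 * w))"
      unfolding w(2) by (rule less_le_trans[rotated]) simp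
    then have "ord w' = 1" using w unfolding w'_def by (subst ord_add_eq) (auto simp: one_ereal_def)
    then have "eisenstein ord s w'" using R by (auto simp: eisenstein_def)
    moreover have "ord (t * y) + ord (t * y) + 1 = ereal (of_int (k + 2 * h))"
      unfolding ordty using k by (cases "ord y") (auto simp: one_ereal_def)
    ultimately show ?thesis unfolding disc_form_def using D' ty by blast
  qed
qed

section \<open>Splitting off pivot blocks\<close>

lemma schur_reduce:
  assumes T: "half_form ord (k + m) a T" and nd: "\<not> defective ord (k + m) a T"
    and V: "half_form ord k (\<lambda>i. - a i) V"
    and inv: "\<And>i j. i < k \<Longrightarrow> j < k \<Longrightarrow> (\<Sum>l<k. T i l * V l j) = (if i = j then 1 else 0)"
  shows "\<exists>b S. half_form ord m b S \<and> \<not> defective ord m b S \<and> dt (k + m) T = dt k T * dt m S \<and>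
    (\<Sum>i<k + m. a i) = (\<Sum>i<k. a i) + (\<Sum>i<m. b i)"
  using schur_half_form[OF T V] schur_defective[OF T V inv] nd dt_schur[OF inv, where m = m]
  by (intro exI[of _ "\<lambda>i. a (k + i)"] exI[of _ "schur k V T"]) (auto simp: sum_lessThan_add)

lemma ord_half_le: "ord (x / 2) \<le> ord x"
  using add_mono[of "ord (x / 2)" "ord (x / 2)" 0 "ord 2"] ord_mult[of "x / 2" 2] by simp

text \<open>By \<open>diag\<close> the off-diagonal square dominates, so the block has determinant
  of valuation exactly \<open>a i + a j\<close>. This is what bounds its inverse by the negated
  weights.\<close>

lemma pivot_two:
  assumes T: "half_form ord n a T" and nd: "\<not> defective ord n a T"
    and ij: "i < n" "j < n" "i \<noteq> j"
    and Tij: "ord (T i j) = ereal ((of_int (a i) + of_int (a j)) / 2)"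
    and diag: "ereal (of_int (a i) + of_int (a j)) < ord (T i i * T j j)"
  obtains m b S where "n = 2 + m" "half_form ord m b S" "\<not> defective ord m b S"
    "dt n T = (T i i * T j j - (T i j)\<^sup>2) * dt m S"
    "(\<Sum>l<n. a l) = a i + a j + (\<Sum>l<m. b l)"
proof -
  obtain p where p: "p permutes {..<n}" "p 0 = i" "p 1 = j"
    using exists_permutes_two[OF ij] by blast
  have "2 \<le> n" using ij by linarith
  then obtain m where m: "n = 2 + m" using le_Suc_ex by blast
  let ?T = "\<lambda>x y. T (p x) (p y)" and ?a = "\<lambda>x. a (p x)"
  define d where "d = T i i * T j j - (T i j)\<^sup>2"
  have sq: "ord ((T i j)\<^sup>2) = ereal (of_int (a i) + of_int (a j))"
    unfolding ord_power2 Tij by simp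
  have d: "ord d = ereal (of_int (a i) + of_int (a j))"
    using ord_add_eq2[of "- (T i j)\<^sup>2" "T i i * T j j"] diag by (simp add: d_def sq)
  have d0: "d \<noteq> 0" using d by auto
  have Tji: "T j i = T i j" using half_form_sym[OF T] ij by simp
  \<comment> \<open>The adjugate over the determinant; \<open>1 - x\<close> exchanges the indices 0
    and 1.\<close>
  define V where "V x y = (if x = y then ?T (1 - x) (1 - x) else - T i j) / d" for x y :: nat
  have V01: "V 0 0 = T j j / d" "V 1 1 = T i i / d" "V 0 1 = - T i j / d" "V 1 0 = - T i j / d"
    using p by (auto simp: V_def)
  have inv: "(\<Sum>l<2. ?T x l * V l y) = (if x = y then 1 else 0)" if "x < 2" "y < 2" for x y
  proof -
    have "(T i i * T j j - T i j * T i j) / d = 1" using d0 by (simp add: d_def power2_eq_square)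
    then have 1: "T i i * T j j / d - T i j * T i j / d = 1" by (simp add: diff_divide_distrib)
    have "(\<Sum>l<2. ?T x l * V l y) = ?T x 0 * V 0 y + ?T x 1 * V 1 y" by (simp add: numeral_2_eq_2)
    then show ?thesis
      using that(1)[THEN less_2_cases] that(2)[THEN less_2_cases] 1
      by (elim disjE) (simp_all add: V01 V01[simplified] p p(3)[simplified] Tji mult.commute)
  qed
  have half: "ord (T l l / d / 2) = ord (T l l / 2) - ereal (of_int (a i) + of_int (a j))" for l
    using ord_divide[OF d, of "T l l / 2"] by (simp add: field_simps)
  have V: "half_form ord 2 (\<lambda>x. - ?a x) V"
    unfolding half_form_def
  proof (intro conjI allI impI)
    have le: "ereal (of_int (- a i)) \<le> ord (T j j / d / 2)" "ereal (of_int (- a j)) \<le> ord (T i i / d / 2)"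
      unfolding half using half_form_diag[OF T ij(1)] half_form_diag[OF T ij(2)]
      by (cases "ord (T j j / 2)"; cases "ord (T i i / 2)"; simp)+
    have off: "ord (- T i j / d) = ereal (- ((of_int (a i) + of_int (a j)) / 2))"
      unfolding ord_divide[OF d] by (simp add: Tij)
    have le2: "ereal (of_int (- a i)) \<le> ord (T j j / d)" "ereal (of_int (- a j)) \<le> ord (T i i / d)"
      using le by (blast intro: order_trans ord_half_le)+
    fix x y :: nat assume x: "x < 2"
    show "ereal (of_int (- ?a x)) \<le> ord (V x x / 2)"
      using x[THEN less_2_cases] le by (elim disjE) (simp_all add: V01 V01[simplified] p p(3)[simplified])
    assume y: "y < 2"
    show "V x y = V y x" by (auto simp: V_def)
    show "ereal ((of_int (- ?a x) + of_int (- ?a y)) / 2) \<le> ord (V x y)"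
      using x[THEN less_2_cases] y[THEN less_2_cases] le2 off
      by (elim disjE) (simp_all add: V01 V01[simplified] p p(3)[simplified])
  qed
  have nd': "\<not> defective ord n ?a ?T" using defective_permute[OF p(1)] nd by blast
  obtain b S where bS: "half_form ord m b S" "\<not> defective ord m b S"
    "dt n ?T = dt 2 ?T * dt m S" "(\<Sum>l<n. ?a l) = (\<Sum>l<2. ?a l) + (\<Sum>l<m. b l)"
    using schur_reduce[of 2 m ?a ?T V, folded m, OF half_form_permute[OF p(1) T] nd' V inv] by blast
  show ?thesis
  proof (rule that[OF m bS(1,2)])
    have "(\<Sum>l<n. ?a l) = (\<Sum>l<n. a l)" using sum.permute[OF p(1), of a] by (simp add: o_def)
    then show "(\<Sum>l<n. a l) = a i + a j + (\<Sum>l<m. b l)"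
      using bS(4) p by (simp add: numeral_2_eq_2)
    show "dt n T = (T i i * T j j - (T i j)\<^sup>2) * dt m S"
      using bS(3) p unfolding dt_permute[OF p(1)] dt_2 by (simp add: Tji power2_eq_square)
  qed
qed

text \<open>The inverse \<open>1 / T i i\<close> has to meet the negated weight even after halving,
  and here \<open>ord 2 = 0\<close> enters.\<close>

lemma pivot_one:
  assumes T: "half_form ord n a T" and nd: "\<not> defective ord n a T"
    and 2: "ord 2 = 0" and i: "i < n" and Tii: "ord (T i i) = ereal (of_int (a i))"
  obtains m b S where "n = 1 + m" "half_form ord m b S" "\<not> defective ord m b S"
    "dt n T = T i i * dt m S" "(\<Sum>l<n. a l) = a i + (\<Sum>l<m. b l)"
proof -
  let ?p = "transpose 0 i"
  have p: "?p permutes {..<n}" "?p 0 = i" using i by (auto intro: permutes_swap_id)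
  obtain m where m: "n = 1 + m" using i by (cases n) auto
  let ?T = "\<lambda>x y. T (?p x) (?p y)" and ?a = "\<lambda>x. a (?p x)"
  have T0: "T i i \<noteq> 0" using Tii by auto
  define V :: "nat \<Rightarrow> nat \<Rightarrow> 'a" where "V = (\<lambda>x y. 1 / T i i)"
  have V1: "ord (1 / T i i) = ereal (- of_int (a i))"
    using ord_divide[OF Tii, of 1] by (simp add: zero_ereal_def)
  have V2: "ord (1 / T i i / 2) = ereal (- of_int (a i))"
    using ord_divide[of 2 0 "1 / T i i"] 2 V1 by (simp add: zero_ereal_def)
  have V: "half_form ord 1 (\<lambda>x. - ?a x) V"
    unfolding half_form_def V_def using V1 V2 by auto
  have nd': "\<not> defective ord n ?a ?T" using defective_permute[OF p(1)] nd by blast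
  have inv: "(\<Sum>l<1. ?T x l * V l y) = (if x = y then 1 else 0)" if "x < 1" "y < 1" for x y :: nat
    using that T0 by (simp add: V_def)
  obtain b S where bS: "half_form ord m b S" "\<not> defective ord m b S"
    "dt n ?T = dt 1 ?T * dt m S" "(\<Sum>l<n. ?a l) = (\<Sum>l<1. ?a l) + (\<Sum>l<m. b l)"
    using schur_reduce[of 1 m ?a ?T V, folded m, OF half_form_permute[OF p(1) T] nd' V inv] by blast
  show ?thesis
  proof (rule that[OF m bS(1,2)])
    have "(\<Sum>l<n. ?a l) = (\<Sum>l<n. a l)" using sum.permute[OF p(1), of a] by (simp add: o_def)
    then show "(\<Sum>l<n. a l) = a i + (\<Sum>l<m. b l)" using bS(4) by simp
    show "dt n T = T i i * dt m S" using bS(3) unfolding dt_permute[OF p(1)] by simp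
  qed
qed

text \<open>Basis vector \<open>i\<close> has norm \<open>a i / 2\<close>. The use is
  contrapositive: in a nondefective form whose column \<open>i\<close> exceeds all its bounds, the
  halved diagonal entry is tight.\<close>

lemma unit_vector_defective:
  assumes T: "half_form ord n a T" and i: "i < n"
    and diag: "ereal (of_int (a i)) < ord (T i i / 2)"
    and row: "\<And>l. l < n \<Longrightarrow> ereal ((of_int (a l) + of_int (a i)) / 2) < ord (T l i)"
  shows "defective ord n a T"
  unfolding defective_def
proof (intro exI[of _ "of_int (a i) / 2"] exI[of _ "\<lambda>l. if l = i then 1 else 0"] exI[of _ i] conjI allI impI)
  show "norm_ge ord n a (of_int (a i) / 2) (\<lambda>l. if l = i then 1 else 0)"
    by (simp add: norm_ge_def zero_ereal_def)
  have sum: "(\<Sum>j<n. f j * (if j = i then 1 else 0)) = f i" for f :: "nat \<Rightarrow> 'a"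
    using i by (simp add: if_distrib[of "\<lambda>x. _ * x"] cong: if_cong)
  have "bil n T (\<lambda>l. if l = i then 1 else 0) (\<lambda>l. if l = i then 1 else 0) = T i i"
    unfolding bil_eq sum using i by (simp add: if_distrib[of "\<lambda>x. x * _"] cong: if_cong)
  then show "ereal (2 * (of_int (a i) / 2))
      < ord (bil n T (\<lambda>l. if l = i then 1 else 0) (\<lambda>l. if l = i then 1 else 0) / 2)"
    using diag by simp
  fix l assume "l < n"
  then show "ereal (of_int (a i) / 2 + of_int (a l) / 2) < ord (\<Sum>j<n. T l j * (if j = i then 1 else 0))"
    unfolding sum using row[of l] by (simp add: add_divide_distrib add.commute)
qed (use i in \<open>auto simp: zero_ereal_def\<close>)

text \<open>Diagonal pivots are tried first, so that afterwards all diagonal entries exceed their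
  bounds, as \<open>pivot_two\<close> demands. If no pivot exists, the first basis vector would be
  defective, unless \<open>n = 0\<close>.\<close>

lemma ord_dt_odd_residue:
  assumes 2: "ord 2 = 0" and "half_form ord n a T" "\<not> defective ord n a T"
  shows "ord (dt n T) = ereal (of_int (\<Sum>i<n. a i))"
  using assms(2,3)
proof (induction n arbitrary: a T rule: less_induct)
  case (less n)
  note T = less.prems(1) and nd = less.prems(2)
  have half: "ord (x / 2) = ord x" for x
    using ord_divide[of 2 0 x] 2 by (simp add: zero_ereal_def)
  show ?case
  proof (cases "\<exists>i<n. ord (T i i) = ereal (of_int (a i))")
    case True
    then obtain i where i: "i < n" "ord (T i i) = ereal (of_int (a i))" by blast
    obtain m b S where "n = 1 + m" and S: "half_form ord m b S" "\<not> defective ord m b S"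
      "dt n T = T i i * dt m S" "(\<Sum>l<n. a l) = a i + (\<Sum>l<m. b l)"
      by (rule pivot_one[OF T nd 2 i])
    then have "ord (dt m S) = ereal (of_int (\<Sum>l<m. b l))" by (intro less.IH) auto
    then show ?thesis unfolding S(3,4) ord_mult i(2) by simp
  next
    case False
    have diag: "ereal (of_int (a i)) < ord (T i i)" if "i < n" for i
      using half_form_diag[OF T that] False that by (auto simp: half less_le)
    show ?thesis
    proof (cases "\<exists>i<n. \<exists>j<n. i \<noteq> j \<and> ord (T i j) = ereal ((of_int (a i) + of_int (a j)) / 2)")
      case True
      then obtain i j where ij: "i < n" "j < n" "i \<noteq> j"
        "ord (T i j) = ereal ((of_int (a i) + of_int (a j)) / 2)" by blast
      have dd: "ereal (of_int (a i) + of_int (a j)) < ord (T i i * T j j)"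
        using diag ij by (intro ord_mult_gt) (auto intro: less_imp_le)
      obtain m b S where "n = 2 + m" and S: "half_form ord m b S" "\<not> defective ord m b S"
        "dt n T = (T i i * T j j - (T i j)\<^sup>2) * dt m S"
        "(\<Sum>l<n. a l) = a i + a j + (\<Sum>l<m. b l)"
        by (rule pivot_two[OF T nd ij dd])
      then have "ord (dt m S) = ereal (of_int (\<Sum>l<m. b l))" by (intro less.IH) auto
      moreover have "ord (T i i * T j j - (T i j)\<^sup>2) = ereal (of_int (a i) + of_int (a j))"
        using ord_add_eq2[of "- (T i j)\<^sup>2" "T i i * T j j"] dd by (simp add: ord_power2 ij(4))
      ultimately show ?thesis unfolding S(3,4) ord_mult by simp
    next
      case off: False
      have "n = 0"
      proof (rule ccontr)
        assume "n \<noteq> 0"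
        then have 0: "0 < n" by simp
        have "defective ord n a T"
        proof (rule unit_vector_defective[OF T 0])
          fix l assume l: "l < n"
          show "ereal ((of_int (a l) + of_int (a 0)) / 2) < ord (T l 0)"
          proof (cases "l = 0")
            case False
            then have "ord (T l 0) \<noteq> ereal ((of_int (a l) + of_int (a 0)) / 2)"
              using off l 0 by blast
            then show ?thesis using half_form_entry[OF T l 0] by (simp only: less_le) simp
          qed (use diag[OF 0] in simp)
        qed (use diag[OF 0] in \<open>simp add: half\<close>)
        then show False using nd by simp
      qed
      then show ?thesis by (simp add: zero_ereal_def)
    qed
  qed
qed

section \<open>Residue characteristic two\<close>

text \<open>
  Among the finitely many residue classes of the iterated squares of \<open>u\<close> two coincide, and
  squaring is injective modulo the maximal ideal in residue characteristic \<open>2\<close>.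
\<close>

lemma square_mod_dyadic:
  assumes 2: "0 < ord 2" and u: "0 \<le> ord u"
  shows "\<exists>t. 0 \<le> ord t \<and> 0 < ord (t\<^sup>2 - u)"
proof -
  let ?rel = "{(x, y). x \<in> val_ring ord \<and> y \<in> val_ring ord \<and> x - y \<in> val_ideal ord}"
  define f where "f i = u ^ 2 ^ i" for i :: nat
  have f0: "f 0 = u" and fS: "f (Suc i) = (f i)\<^sup>2" for i
    by (simp_all add: f_def power_mult[symmetric] mult.commute)
  have fint: "0 \<le> ord (f i)" for i
    by (induction i) (use u in \<open>auto simp: f0 fS power2_eq_square intro: ord_mult_ge0\<close>)
  have "range (\<lambda>i. ?rel `` {f i}) \<subseteq> val_ring ord // ?rel"
  proof clarify
    fix i show "?rel `` {f i} \<in> val_ring ord // ?rel"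
      by (rule quotientI) (simp add: val_ring_def fint)
  qed
  then have "finite (range (\<lambda>i. ?rel `` {f i}))"
    using finite_residue_field finite_subset by blast
  then have "\<not> inj (\<lambda>i. ?rel `` {f i})"
    using range_inj_infinite by blast
  then obtain i j where ij: "i \<noteq> j" "?rel `` {f i} = ?rel `` {f j}"
    unfolding inj_def by blast
  have "f j \<in> ?rel `` {f j}" using fint by (auto simp: val_ring_def val_ideal_def)
  then have "f j \<in> ?rel `` {f i}" using ij(2) by simp
  then have "0 < ord (f i - f j)" by (auto simp: val_ideal_def)
  then obtain i d where id: "0 < ord (f (i + Suc d) - f i)"
    using ij(1) by (metis less_imp_Suc_add linorder_neqE_nat ord_minus_commute add_Suc_right)
  have "0 < ord (f (k + Suc d) - f k) \<Longrightarrow> 0 < ord (f (Suc d) - f 0)" for k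
  proof (induction k)
    case (Suc k)
    let ?x = "f (k + Suc d)" and ?y = "f k"
    have "0 < ord ((?x - ?y) * (?x + ?y))"
      using Suc.prems by (simp add: fS algebra_simps power2_eq_square)
    then have "0 < ord (?x - ?y) + ord (?x + ?y)" by (simp add: ord_mult)
    \<comment> \<open>Sum and difference differ by \<open>2 * ?y\<close>, which lies in the maximal
      ideal. If the difference did not, the sum would have the same valuation, and the product would
      not have positive valuation.\<close>
    have "0 < ord (?x - ?y)"
    proof (rule ccontr)
      assume neg: "\<not> 0 < ord (?x - ?y)"
      have "ereal (0 + 0) < ord (2 * ?y)"
        using 2 fint by (intro ord_mult_gt) (auto simp flip: zero_ereal_def)
      then have "ord (?x - ?y) < ord (2 * ?y)" using neg by (simp flip: zero_ereal_def)
      then have "ord (?x - ?y + 2 * ?y) = ord (?x - ?y)" by (rule ord_add_eq)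
      then have "ord (?x + ?y) = ord (?x - ?y)" by (simp add: algebra_simps)
      then show False using \<open>0 < ord (?x - ?y) + ord (?x + ?y)\<close> neg
        by (cases "ord (?x - ?y)") auto
    qed
    then show ?case by (rule Suc.IH)
  qed simp
  \<comment> \<open>\<open>f (Suc d)\<close> is the square of \<open>f d\<close>, so
    \<open>f d\<close> is the required root.\<close>
  from this[OF id] have "0 < ord ((f d)\<^sup>2 - u)" by (simp add: fS f0)
  then show ?thesis using fint by blast
qed

text \<open>In lowest degree the form is diagonal. As the weights agree modulo 2, scaling coordinate
  \<open>i\<close> by some \<open>c\<close> of valuation \<open>(a j - a i) / 2\<close> brings it to
  the norm of basis vector \<open>j\<close>. There remains \<open>c\<^sup>2 A t\<^sup>2 + C\<close>,
  and a square root modulo the maximal ideal supplies a \<open>t\<close> that kills its leading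
  part.\<close>

lemma off_diagonal_small_defective:
  assumes 2: "0 < ord 2" and T: "half_form ord n a T" and ij: "i < n" "j < n" "i \<noteq> j"
    and off: "\<And>l m. l < n \<Longrightarrow> m < n \<Longrightarrow> ereal ((of_int (a l) + of_int (a m)) / 2) < ord (T l m)"
    and diag: "ord (T i i / 2) = ereal (of_int (a i))" "ord (T j j / 2) = ereal (of_int (a j))"
    and par: "even (a i - a j)"
  shows "defective ord n a T"
proof -
  obtain h where h: "a j - a i = 2 * h" using par by (metis dvd_minus_iff minus_diff_eq evenE)
  obtain c where c: "c \<noteq> 0" "ord c = ereal (of_int h)" using ord_exists by blast
  define A where "A = T i i / 2"
  define C where "C = T j j / 2"
  have A: "ord A = ereal (of_int (a i))" "A \<noteq> 0" and C: "ord C = ereal (of_int (a j))"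
    using diag by (auto simp: A_def C_def)
  have c2A: "ord (c\<^sup>2 * A) = ereal (of_int (a j))"
    using h c A by (simp add: ord_mult ord_power2 flip: of_int_add)
  have "ord (- C / (c\<^sup>2 * A)) = 0"
    using ord_divide[OF c2A, of "- C"] C by (simp add: zero_ereal_def)
  then obtain t where t: "0 \<le> ord t" "0 < ord (t\<^sup>2 - (- C / (c\<^sup>2 * A)))"
    using square_mod_dyadic[OF 2, of "- C / (c\<^sup>2 * A)"] by auto
  define x where "x l = (if l = i then t * c else if l = j then 1 else 0)" for l
  have tc: "ereal (of_int h) \<le> ord (t * c)"
    using ord_mult_ge[of 0 t "of_int h" c] t c by (simp flip: zero_ereal_def)
  have hr: "of_int (a j) = of_int (a i) + 2 * (of_int h :: real)" using h by linarith
  have row: "(\<Sum>m<n. T l m * x m) = T l i * (t * c) + T l j" for l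
  proof -
    have "(\<Sum>m<n. T l m * x m) = (\<Sum>m\<in>{i, j}. T l m * x m)"
      using ij by (intro sum.mono_neutral_right) (auto simp: x_def)
    then show ?thesis using ij by (simp add: x_def)
  qed
  have "bil n T x x = (\<Sum>l\<in>{i, j}. x l * (T l i * (t * c) + T l j))"
    unfolding bil_eq row using ij by (intro sum.mono_neutral_right) (auto simp: x_def)
  then have bil: "bil n T x x / 2 = (c\<^sup>2 * A) * (t\<^sup>2 - (- C / (c\<^sup>2 * A))) + t * c * T i j"
    using ij c A half_form_sym[OF T ij(2,1)]
    by (simp add: x_def A_def C_def field_simps power2_eq_square)
  show ?thesis unfolding defective_def
  proof (intro exI[of _ "of_int (a j) / 2"] exI[of _ x] exI[of _ j] conjI allI impI)
    show "norm_ge ord n a (of_int (a j) / 2) x"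
      unfolding norm_ge_def using tc by (auto simp: x_def hr)
    show "ord (x j) = ereal (of_int (a j) / 2 - of_int (a j) / 2)"
      using ij by (simp add: x_def zero_ereal_def)
    have "ereal (of_int (a j) + 0) < ord ((c\<^sup>2 * A) * (t\<^sup>2 - (- C / (c\<^sup>2 * A))))"
      using c2A t by (intro ord_mult_gt2) (auto simp flip: zero_ereal_def)
    moreover have "ereal (of_int h + (of_int (a i) + of_int (a j)) / 2) < ord (t * c * T i j)"
      using tc off[OF ij(1,2)] by (intro ord_mult_gt2)
    ultimately show "ereal (2 * (of_int (a j) / 2)) < ord (bil n T x x / 2)"
      unfolding bil by (intro ord_add_gt) (auto elim!: ereal_less_weaken simp: hr)
    fix l assume l: "l < n"
    have "ereal ((of_int (a l) + of_int (a i)) / 2 + of_int h) < ord (T l i * (t * c))"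
      using tc off[OF l ij(1)] by (intro ord_mult_gt)
    then have "ereal (of_int (a j) / 2 + of_int (a l) / 2) < ord (T l i * (t * c))"
      by (rule ereal_less_weaken) (simp add: hr add_divide_distrib)
    moreover have "ereal (of_int (a j) / 2 + of_int (a l) / 2) < ord (T l j)"
      by (rule ereal_less_weaken[OF off[OF l ij(2)]]) (simp add: add_divide_distrib)
    ultimately show "ereal (of_int (a j) / 2 + of_int (a l) / 2) < ord (\<Sum>m<n. T l m * x m)"
      unfolding row by (intro ord_add_gt)
  qed (use ij in auto)
qed

text \<open>Binary pivots lower the rank by 2; in even rank \<open>disc_form_mult\<close> accounts
  for them. Once none is left, every halved diagonal entry is tight and the weights differ pairwise
  in parity, which leaves at most two indices.\<close>

lemma disc_form_dyadic:
  assumes 2: "0 < ord 2" and "half_form ord n a T" "\<not> defective ord n a T"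
  shows "(odd n \<longrightarrow> ord (dt n T / 2) = ereal (of_int (\<Sum>i<n. a i))) \<and>
    (even n \<longrightarrow> disc_form ord ((-1) ^ (n div 2) * dt n T) (\<Sum>i<n. a i))"
  using assms(2,3)
proof (induction n arbitrary: a T rule: less_induct)
  case (less n)
  note T = less.prems(1) and nd = less.prems(2)
  \<comment> \<open>The weight bounds \<open>T i i / 2\<close>, and 2 has positive valuation, so the
    entry \<open>T i i\<close> itself is never tight. Unary pivots do not arise.\<close>
  have diag: "ereal (of_int (a i)) < ord (T i i)" if "i < n" for i
  proof -
    have "ereal (of_int (a i) + 0) < ord (T i i / 2 * 2)"
      using half_form_diag[OF T that] 2 by (intro ord_mult_gt2) (auto simp flip: zero_ereal_def)
    then show ?thesis by simp
  qed
  show ?case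
  proof (cases "\<exists>i<n. \<exists>j<n. i \<noteq> j \<and> ord (T i j) = ereal ((of_int (a i) + of_int (a j)) / 2)")
    case True
    then obtain i j where ij: "i < n" "j < n" "i \<noteq> j"
      "ord (T i j) = ereal ((of_int (a i) + of_int (a j)) / 2)" by blast
    have dd: "ereal (of_int (a i) + of_int (a j)) < ord (T i i * T j j)"
      using diag ij by (intro ord_mult_gt) (auto intro: less_imp_le)
    obtain m b S where m: "n = 2 + m" and S: "half_form ord m b S" "\<not> defective ord m b S"
      "dt n T = (T i i * T j j - (T i j)\<^sup>2) * dt m S"
      "(\<Sum>l<n. a l) = a i + a j + (\<Sum>l<m. b l)"
      by (rule pivot_two[OF T nd ij dd])
    have IH: "(odd m \<longrightarrow> ord (dt m S / 2) = ereal (of_int (\<Sum>i<m. b i))) \<and>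
      (even m \<longrightarrow> disc_form ord ((-1) ^ (m div 2) * dt m S) (\<Sum>i<m. b i))"
      using m S by (intro less.IH) auto
    have t0: "T i j \<noteq> 0" using ij(4) by auto
    obtain h :: int where h: "ord (T i j) = ereal (of_int h)" using ord_nonzeroE[OF t0] by blast
    have "of_int (2 * h) = (of_int (a i + a j) :: real)" using h ij(4) by simp
    then have h2: "a i + a j = 2 * h" by (simp only: of_int_eq_iff)
    have t2: "ord ((T i j)\<^sup>2) = ereal (of_int (a i) + of_int (a j))"
      unfolding ord_power2 ij(4) by simp
    define v where "v = (T i i / 2) * (T j j / 2) / (T i j)\<^sup>2"
    have "ereal (of_int (a i) + of_int (a j)) \<le> ord ((T i i / 2) * (T j j / 2))"
      by (intro ord_mult_ge half_form_diag[OF T] ij)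
    then have v: "0 \<le> ord v"
      unfolding v_def ord_divide[OF t2] by (cases "ord ((T i i / 2) * (T j j / 2))") auto
    \<comment> \<open>The minus sign is taken up by the change of \<open>(-1) ^ (n div 2)\<close>
      when the rank drops by 2.\<close>
    have d: "T i i * T j j - (T i j)\<^sup>2 = - ((T i j)\<^sup>2 * (1 - 4 * v))"
      using t0 by (simp add: v_def field_simps)
    show ?thesis
    proof (intro conjI impI)
      assume "odd n"
      then have "ord (dt m S / 2) = ereal (of_int (\<Sum>i<m. b i))" using IH m by simp
      moreover have "dt n T / 2 = - ((T i j)\<^sup>2 * (1 - 4 * v)) * (dt m S / 2)"
        unfolding S(3) d by simp
      ultimately have "ord (dt n T / 2) = ereal (of_int (a i) + of_int (a j)) + 0 + ereal (of_int (\<Sum>i<m. b i))"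
        by (simp only: ord_mult ord_minus t2 ord_1_minus_4[OF 2 v])
      then show "ord (dt n T / 2) = ereal (of_int (\<Sum>i<n. a i))" unfolding S(4) by simp
    next
      assume "even n"
      then have "disc_form ord ((-1) ^ (m div 2) * dt m S) (\<Sum>i<m. b i)" using IH m by simp
      from disc_form_mult[OF 2 this h v]
      have "disc_form ord ((T i j)\<^sup>2 * (1 - 4 * v) * ((-1) ^ (m div 2) * dt m S)) (\<Sum>i<n. a i)"
        by (simp add: S(4) h2 add.commute)
      moreover have "(-1) ^ (n div 2) * dt n T = (T i j)\<^sup>2 * (1 - 4 * v) * ((-1) ^ (m div 2) * dt m S)"
      proof -
        have "(-1) ^ (n div 2) = - ((-1) ^ (m div 2) :: 'a)" using m by simp
        then show ?thesis unfolding S(3) d by simp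
      qed
      ultimately show "disc_form ord ((-1) ^ (n div 2) * dt n T) (\<Sum>i<n. a i)" by simp
    qed
  next
    case False
    have off: "ereal ((of_int (a l) + of_int (a m)) / 2) < ord (T l m)" if "l < n" "m < n" for l m
    proof (cases "l = m")
      case True
      then show ?thesis using diag that by simp
    next
      case ne: False
      have "ord (T l m) \<noteq> ereal ((of_int (a l) + of_int (a m)) / 2)"
        using ne that False by blast
      then show ?thesis using half_form_entry[OF T that] by (simp only: less_le) simp
    qed
    have exact: "ord (T i i / 2) = ereal (of_int (a i))" if i: "i < n" for i
    proof (rule ccontr)
      assume "ord (T i i / 2) \<noteq> ereal (of_int (a i))"
      then have "ereal (of_int (a i)) < ord (T i i / 2)"
        using half_form_diag[OF T i] by (simp only: less_le) simp
      from unit_vector_defective[OF T i this off[OF _ i]] show False using nd by simp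
    qed
    have par: "odd (a i - a j)" if "i < n" "j < n" "i \<noteq> j" for i j
      using off_diagonal_small_defective[OF 2 T that off exact exact] nd that by blast
    have "n \<le> 2"
    proof (rule ccontr)
      assume "\<not> n \<le> 2"
      then have "0 < n" "1 < n" "2 < n" by auto
      then have "odd (a 0 - a 1)" "odd (a 1 - a 2)" "odd (a 0 - a 2)"
        using par[of 0 1] par[of 1 2] par[of 0 2] by presburger+
      then show False by presburger
    qed
    then consider "n = 0" | "n = 1" | "n = 2" by linarith
    then show ?thesis
    proof cases
      case 1
      \<comment> \<open>The empty form has determinant 1, the discriminant of
        \<open>X\<^sup>2 - X\<close>.\<close>
      have U: "unit_disc ord 1 0" by (simp add: unit_disc_def)
      have "disc_form ord 1 0" unfolding disc_form_def
        by (rule exI[of _ 1], rule exI[of _ 1], rule exI[of _ 0]) (simp add: U zero_ereal_def)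
      then show ?thesis using 1 by simp
    next
      case 2
      then show ?thesis using exact[of 0] by simp
    next
      case 3
      have "odd (a 0 - a 1)" using 3 by (intro par) auto
      then have "odd (a 0 + a 1)" by presburger
      then obtain l where l: "a 0 + a 1 = 2 * l + 1" by (elim oddE)
      then have l': "of_int (a 0) + of_int (a 1) = 2 * of_int l + (1 :: real)"
        by (metis of_int_1 of_int_add of_int_mult of_int_numeral)
      \<comment> \<open>The weights have sum \<open>2 * l + 1\<close>. Dividing by
        \<open>y\<^sup>2\<close> leaves valuation 1 for the product of the halved diagonal entries;
        the off-diagonal entry lies above \<open>l + 1 / 2\<close>, so its quotient by
        \<open>y\<close> has positive valuation.\<close>
      obtain y where y: "y \<noteq> 0" "ord y = ereal (of_int l)" using ord_exists by blast
      have y2: "ord (y\<^sup>2) = ereal (2 * of_int l)" by (simp add: ord_power2 y)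
      define s where "s = T 0 1 / y"
      define w where "w = (T 0 0 / 2) * (T 1 1 / 2) / y\<^sup>2"
      have "ord (T 0 0 / 2 * (T 1 1 / 2)) = ereal (2 * of_int l + 1)"
        using exact[of 0] exact[of 1] 3 l' by (simp only: ord_mult) simp
      then have w: "ord w = 1" unfolding w_def ord_divide[OF y2] by (simp add: one_ereal_def)
      have "ereal (of_int l + 1 / 2) < ord (T 0 1)"
        by (rule ereal_less_weaken[OF off[of 0 1]]) (use 3 l' in auto)
      then have "0 < ord s" unfolding s_def ord_divide[OF y(2)] by (cases "ord (T 0 1)") auto
      then have "1 \<le> ord s" by (rule ord_gt_0)
      then have R: "eisenstein ord s w" using w by (simp add: eisenstein_def)
      have "T 1 0 = T 0 1" using half_form_sym[OF T] 3 by simp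
      then have D: "(-1) ^ (n div 2) * dt n T = y\<^sup>2 * (s\<^sup>2 - 4 * w)"
        unfolding 3 dt_2 using y(1) by (simp add: s_def w_def field_simps power2_eq_square)
      have "(\<Sum>i<n. a i) = 2 * l + 1" using 3 l by (simp add: numeral_2_eq_2)
      then have "ord y + ord y + 1 = ereal (of_int (\<Sum>i<n. a i))" using y by (simp add: one_ereal_def)
      then show ?thesis using R D y(1) 3 unfolding disc_form_def by auto
    qed
  qed
qed

lemma nondefective_dt:
  assumes "half_form ord n a T" "\<not> defective ord n a T"
  shows "odd n \<Longrightarrow> ord (dt n T / 2) = ereal (of_int (\<Sum>i<n. a i))"
    and "even n \<Longrightarrow> disc_form ord ((-1) ^ (n div 2) * dt n T) (\<Sum>i<n. a i)"
proof -
  have "(odd n \<longrightarrow> ord (dt n T / 2) = ereal (of_int (\<Sum>i<n. a i))) \<and>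
    (even n \<longrightarrow> disc_form ord ((-1) ^ (n div 2) * dt n T) (\<Sum>i<n. a i))"
  proof (cases "ord 2 = 0")
    case True
    have "ord ((-1) ^ (n div 2) * dt n T) = ord (dt n T)"
      by (cases "even (n div 2)") auto
    moreover have "ord (dt n T / 2) = ord (dt n T)"
      using ord_divide[of 2 0 "dt n T"] True by (simp add: zero_ereal_def)
    ultimately show ?thesis
      using ord_dt_odd_residue[OF True assms] disc_form_odd_residue[OF True] by simp
  next
    case False
    then have "0 < ord 2" using ord_numeral_ge[of "num.Bit0 num.One"] by (simp add: less_le)
    then show ?thesis by (rule disc_form_dyadic[OF _ assms])
  qed
  then show "odd n \<Longrightarrow> ord (dt n T / 2) = ereal (of_int (\<Sum>i<n. a i))"
    and "even n \<Longrightarrow> disc_form ord ((-1) ^ (n div 2) * dt n T) (\<Sum>i<n. a i)" by auto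
qed

text \<open>In each term of the Leibniz expansion every weight occurs once through a row and once
  through a column, each time halved. The bound limits the admissible sequences \<open>a\<close>;
  with zero weights it makes determinants of integral matrices integral.\<close>

lemma ord_dt_ge:
  assumes "\<And>i j. i < n \<Longrightarrow> j < n \<Longrightarrow> ereal ((a i + a j) / 2) \<le> ord (T i j)"
  shows "ereal (\<Sum>i<n. a i) \<le> ord (dt n T)"
proof -
  have dt: "dt n T = (\<Sum>p\<in>{p. p permutes {0..<n}}. signof p * (\<Prod>i = 0..<n. T i (p i)))"
  proof -
    have "(\<Prod>i = 0..<n. mat n n (\<lambda>(i, j). T i j) $$ (i, p i)) = (\<Prod>i = 0..<n. T i (p i))"
      if "p permutes {0..<n}" for p
      by (intro prod.cong) (use permutes_in_image[OF that] in auto)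
    then show ?thesis unfolding dt_def det_def by auto
  qed
  show ?thesis unfolding dt
  proof (intro ord_sum_ge)
    fix p assume "p \<in> {p. p permutes {0..<n}}"
    then have p: "p permutes {..<n}" by (simp add: atLeast0LessThan)
    have lt: "p i < n" if "i < n" for i using permutes_in_image[OF p, of i] that by simp
    have sp: "(\<Sum>i<n. a (p i)) = (\<Sum>i<n. a i)"
      using sum.permute[OF p, of a] by (simp add: o_def)
    have "ereal (\<Sum>i<n. (a i + a (p i)) / 2) = (\<Sum>i<n. ereal ((a i + a (p i)) / 2))" by simp
    also have "\<dots> \<le> (\<Sum>i<n. ord (T i (p i)))" using assms lt by (intro sum_mono) auto
    also have "\<dots> = ord (\<Prod>i<n. T i (p i))" by (simp add: ord_prod)
    finally have "ereal (\<Sum>i<n. a i) \<le> ord (\<Prod>i<n. T i (p i))"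
      by (simp add: sum.distrib sp flip: sum_divide_distrib)
    then show "ereal (\<Sum>i<n. a i) \<le> ord (signof p * (\<Prod>i = 0..<n. T i (p i)))"
      by (simp add: atLeast0LessThan sign_def)
  qed
qed

section \<open>Normalized defect vectors and the change of basis\<close>

text \<open>
  The coordinates of a defect vector outside its leading degree can be dropped, and it can be
  scaled so that its last leading coordinate is \<open>1\<close>.
\<close>

lemma defective_normalized:
  assumes T: "half_form ord n a T" and d: "defective ord n a T"
  obtains i z where "i < n" "z i = 1" "\<And>l. i < l \<Longrightarrow> z l = 0"
    "norm_ge ord n a (of_int (a i) / 2) z" "ereal (of_int (a i)) < ord (bil n T z z / 2)"
    "\<And>l. l < n \<Longrightarrow> ereal ((of_int (a l) + of_int (a i)) / 2) < ord (\<Sum>j<n. T l j * z j)"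
proof -
  obtain r x where x: "norm_ge ord n a r x"
    "\<exists>i<n. ord (x i) = ereal (r - of_int (a i) / 2)"
    "ereal (2 * r) < ord (bil n T x x / 2)"
    "\<And>i. i < n \<Longrightarrow> ereal (r + of_int (a i) / 2) < ord (\<Sum>j<n. T i j * x j)"
    using d unfolding defective_def by blast
  define I where "I = {i. i < n \<and> ord (x i) = ereal (r - of_int (a i) / 2)}"
  have I: "finite I" "I \<noteq> {}" using x(2) by (auto simp: I_def)
  define i where "i = Max I"
  have "i \<in> I" unfolding i_def using I by (rule Max_in)
  then have i: "i < n" "ord (x i) = ereal (r - of_int (a i) / 2)" by (auto simp: I_def)
  have last: "l \<notin> I" if "i < l" for l using Max_ge[OF I(1), of l] that by (auto simp: i_def)
  define c where "c = x i"
  have c: "c \<noteq> 0" "ord c = ereal (r - of_int (a i) / 2)" using i by (auto simp: c_def)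
  obtain g :: int where g: "ord c = ereal (of_int g)" using ord_nonzeroE[OF c(1)] by blast
  have "of_int g = r - of_int (a i) / 2" using g unfolding c(2) by simp
  \<comment> \<open>As \<open>ord c\<close> is an integer, \<open>2 * r\<close> is one as well. A
    coordinate outside \<open>I\<close> therefore exceeds its bound by at least a half.\<close>
  then have rg: "r = of_int (2 * g + a i) / 2" by simp
  define u where "u l = (if l \<in> I then x l else 0)" for l
  define v where "v l = (if l \<in> I then 0 else x l)" for l
  have xuv: "x = (\<lambda>l. u l + v l)" by (auto simp: u_def v_def)
  have u: "norm_ge ord n a r u" using x(1) by (auto simp: norm_ge_def u_def)
  have v: "norm_ge ord n a (r + 1 / 2) v" unfolding norm_ge_def
  proof (intro allI impI)
    fix l assume l: "l < n"
    show "ereal (r + 1 / 2 - of_int (a l) / 2) \<le> ord (v l)"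
    proof (cases "l \<in> I")
      case False
      then have "ord (x l) \<noteq> ereal (r - of_int (a l) / 2)" using l by (simp add: I_def)
      then have "ereal (r - of_int (a l) / 2) < ord (x l)"
        using x(1) l unfolding norm_ge_def by (simp only: less_le) simp
      then have "ereal (of_int (2 * g + a i - a l) / 2) < ord (x l)"
        by (simp add: rg diff_divide_distrib)
      then have "ereal ((of_int (2 * g + a i - a l) + 1) / 2) \<le> ord (x l)"
        by (rule ord_ge_half_int)
      then have "ereal (r + 1 / 2 - of_int (a l) / 2) \<le> ord (x l)"
        by (rule ereal_le_weaken) (simp add: rg add_divide_distrib diff_divide_distrib)
      then show ?thesis using False by (simp add: v_def)
    qed (simp add: v_def)
  qed
  have sym: "bil n T v u = bil n T u v" by (rule bil_sym[OF half_form_sym[OF T]])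
  \<comment> \<open>All terms that involve \<open>v\<close> have valuation above
    \<open>2 * r\<close>, so \<open>u\<close> inherits the strict bound from
    \<open>x\<close>.\<close>
  have "bil n T u u / 2 = bil n T x x / 2 - bil n T u v - bil n T v v / 2"
    unfolding xuv bil_add sym by (simp add: field_simps)
  also have "ereal (2 * r) < ord \<dots>"
  proof (intro ord_diff_gt x(3))
    have "ereal (2 * r) < ereal (r + (r + 1 / 2))" by simp
    also have "\<dots> \<le> ord (bil n T u v)" by (rule bil_ge[OF T u v])
    finally show "ereal (2 * r) < ord (bil n T u v)" .
    have "ereal (2 * r) < ereal (2 * (r + 1 / 2))" by simp
    also have "\<dots> \<le> ord (bil n T v v / 2)" by (rule quad_ge[OF T v])
    finally show "ereal (2 * r) < ord (bil n T v v / 2)" .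
  qed
  finally have uu: "ereal (2 * r) < ord (bil n T u u / 2)" .
  have row: "ereal (r + of_int (a l) / 2) < ord (\<Sum>j<n. T l j * u j)" if l: "l < n" for l
  proof -
    have "(\<Sum>j<n. T l j * u j) = (\<Sum>j<n. T l j * x j) - (\<Sum>j<n. T l j * v j)"
      unfolding xuv by (simp add: algebra_simps sum.distrib)
    also have "ereal (r + of_int (a l) / 2) < ord \<dots>"
    proof (intro ord_diff_gt x(4) l)
      have "ereal (r + of_int (a l) / 2) < ereal (r + 1 / 2 + of_int (a l) / 2)" by simp
      also have "\<dots> \<le> ord (\<Sum>j<n. T l j * v j)" by (rule row_ge[OF T v l order_refl])
      finally show "ereal (r + of_int (a l) / 2) < ord (\<Sum>j<n. T l j * v j)" .
    qed
    finally show ?thesis .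
  qed
  define z where "z l = inverse c * u l" for l
  have ic: "ord (inverse c) = ereal (of_int (a i) / 2 - r)" using ord_inverse[OF c(2)] by simp
  show ?thesis
  proof (rule that[of i z])
    show "z i = 1" using c \<open>i \<in> I\<close> by (simp add: z_def u_def c_def)
    show "z l = 0" if "i < l" for l using last[OF that] by (simp add: z_def u_def)
    show "norm_ge ord n a (of_int (a i) / 2) z" unfolding norm_ge_def
    proof (intro allI impI)
      fix l assume "l < n"
      then have "ereal (of_int (a i) / 2 - r + (r - of_int (a l) / 2)) \<le> ord (z l)"
        using u ic unfolding z_def norm_ge_def by (intro ord_mult_ge) auto
      then show "ereal (of_int (a i) / 2 - of_int (a l) / 2) \<le> ord (z l)" by simp
    qed
    have ic2: "ord ((inverse c)\<^sup>2) = ereal (of_int (a i) - 2 * r)"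
      unfolding ord_power2 ic by (simp add: field_simps)
    have "bil n T z z / 2 = (inverse c)\<^sup>2 * (bil n T u u / 2)"
      unfolding z_def bil_scale by simp
    moreover have "ereal ((of_int (a i) - 2 * r) + 2 * r) < ord ((inverse c)\<^sup>2 * (bil n T u u / 2))"
      using ic2 uu by (intro ord_mult_gt2) auto
    ultimately show "ereal (of_int (a i)) < ord (bil n T z z / 2)" by simp
    fix l assume l: "l < n"
    have "(\<Sum>j<n. T l j * z j) = inverse c * (\<Sum>j<n. T l j * u j)"
      by (simp add: z_def sum_distrib_left mult_ac)
    moreover have "ereal ((of_int (a i) / 2 - r) + (r + of_int (a l) / 2))
        < ord (inverse c * (\<Sum>j<n. T l j * u j))"
      using ic row[OF l] by (intro ord_mult_gt2) auto
    ultimately show "ereal ((of_int (a l) + of_int (a i)) / 2) < ord (\<Sum>j<n. T l j * z j)"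
      by (simp add: add_divide_distrib add.commute)
  qed (rule i)
qed

text \<open>Valuations are integers, so the strict bounds of a defect round up: by 1 for the halved
  diagonal entry at \<open>i\<close>, by a half for the other entries of row \<open>i\<close>. These
  are the bounds for the weight \<open>a i + 1\<close>.\<close>

lemma half_form_col_subst:
  assumes T: "half_form ord n a T" and i: "i < n"
    and q: "ereal (of_int (a i)) < ord (bil n T z z / 2)"
    and row: "\<And>l. l < n \<Longrightarrow> ereal ((of_int (a l) + of_int (a i)) / 2) < ord (\<Sum>j<n. T l j * z j)"
  shows "half_form ord n (\<lambda>l. if l = i then a l + 1 else a l)
    (\<lambda>k l. bil n T (\<lambda>j. col_subst i z j k) (\<lambda>j. col_subst i z j l))"
proof -
  have q1: "ereal (of_int (a i) + 1) \<le> ord (bil n T z z / 2)" by (rule ord_gt_int[OF q])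
  have q2: "ereal (of_int (a i) + 1) \<le> ord (bil n T z z)"
    by (rule order_trans[OF q1 ord_half_le])
  have row1: "ereal ((of_int (a l) + of_int (a i) + 1) / 2) \<le> ord (\<Sum>j<n. T l j * z j)"
    if "l < n" for l
    using ord_ge_half_int[of "a l + a i"] row[OF that] by simp
  have sub: "bil n T (\<lambda>j. col_subst i z j k) (\<lambda>j. col_subst i z j l) =
    (if k = i then if l = i then bil n T z z else (\<Sum>j<n. T l j * z j)
     else if l = i then (\<Sum>j<n. T k j * z j) else T k l)" if "k < n" "l < n" for k l
    by (rule bil_col_subst[OF that half_form_sym[OF T]])
  show ?thesis unfolding half_form_def
  proof (intro conjI allI impI)
    fix k l assume kl: "k < n" "l < n"
    show "bil n T (\<lambda>j. col_subst i z j k) (\<lambda>j. col_subst i z j l)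
        = bil n T (\<lambda>j. col_subst i z j l) (\<lambda>j. col_subst i z j k)"
      by (rule bil_sym[OF half_form_sym[OF T]])
    show "ereal ((of_int (if k = i then a k + 1 else a k) + of_int (if l = i then a l + 1 else a l)) / 2)
        \<le> ord (bil n T (\<lambda>j. col_subst i z j k) (\<lambda>j. col_subst i z j l))"
      unfolding sub[OF kl] using q2 row1[OF kl(1)] row1[OF kl(2)] half_form_entry[OF T kl]
      by (auto simp: algebra_simps)
  next
    fix k assume k: "k < n"
    show "ereal (of_int (if k = i then a k + 1 else a k))
        \<le> ord (bil n T (\<lambda>j. col_subst i z j k) (\<lambda>j. col_subst i z j k) / 2)"
      unfolding sub[OF k k] using q1 half_form_diag[OF T k] by auto
  qed
qed

end

section \<open>Lexicographic maximality\<close>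

lemma mat_transform_index:
  fixes B :: "'a::field_char_0 mat"
  assumes "B \<in> carrier_mat n n" "U \<in> carrier_mat n n" "k < n" "l < n"
  shows "mat_transform B U $$ (k, l) =
    bil n (\<lambda>i j. B $$ (i, j)) (\<lambda>i. U $$ (i, k)) (\<lambda>j. U $$ (j, l))"
proof -
  have "mat_transform B U = transpose_mat U * (B * U)"
    unfolding mat_transform_def using assms by (intro assoc_mult_mat[of _ n n _ n _ n]) auto
  then show ?thesis
    using assms by (simp add: bil_eq scalar_prod_def atLeast0LessThan)
qed

lemma mat_transform_carrier:
  "B \<in> carrier_mat n n \<Longrightarrow> U \<in> carrier_mat n n \<Longrightarrow> mat_transform B U \<in> carrier_mat n n"
  by (simp add: mat_transform_def)

lemma mat_transform_mult:
  fixes B :: "'a::field_char_0 mat"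
  assumes "B \<in> carrier_mat n n" "U \<in> carrier_mat n n" "W \<in> carrier_mat n n"
  shows "mat_transform (mat_transform B U) W = mat_transform B (U * W)"
proof -
  have t: "transpose_mat (U * W) = transpose_mat W * transpose_mat U"
    using assms by (intro transpose_mult)
  have "transpose_mat W * (transpose_mat U * B * U) * W
      = transpose_mat W * transpose_mat U * B * (U * W)"
    using assms by (simp add: assoc_mult_mat[of _ n n _ n _ n])
  then show ?thesis unfolding mat_transform_def t .
qed

lemma mat_transform_symmetric:
  fixes B :: "'a::field_char_0 mat"
  assumes B: "B \<in> carrier_mat n n" "transpose_mat B = B" and U: "U \<in> carrier_mat n n"
  shows "transpose_mat (mat_transform B U) = mat_transform B U"
proof -
  have "transpose_mat (transpose_mat U * B * U) = transpose_mat U * transpose_mat (transpose_mat U * B)"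
    using B U by (intro transpose_mult[of _ n n _ n]) auto
  also have "transpose_mat (transpose_mat U * B) = transpose_mat B * U"
    using B U by (subst transpose_mult[of _ n n _ n]) auto
  finally show ?thesis unfolding mat_transform_def using B U by (simp add: assoc_mult_mat[of _ n n _ n _ n])
qed

lemma det_mat_transform:
  fixes B :: "'a::field_char_0 mat"
  assumes "B \<in> carrier_mat n n" "U \<in> carrier_mat n n"
  shows "det (mat_transform B U) = (det U)\<^sup>2 * det B"
  using assms by (simp add: mat_transform_def det_mult[of _ n] det_transpose power2_eq_square)

lemma dt_double:
  fixes B :: "'a::field_char_0 mat"
  assumes "B \<in> carrier_mat n n"
  shows "dt n (\<lambda>i j. 2 * B $$ (i, j)) = 2 ^ n * det B"
proof -
  have "mat n n (\<lambda>(i, j). 2 * B $$ (i, j)) = 2 \<cdot>\<^sub>m B"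
    using assms by (intro eq_matI) auto
  then show ?thesis using assms by (simp add: dt_def)
qed

lemma list_update_Suc_greater:
  fixes a :: "nat list"
  assumes "i < length a"
  shows "a < a[i := Suc (a ! i)]"
proof -
  have 1: "a = take i a @ (a ! i) # drop (Suc i) a" by (rule id_take_nth_drop[OF assms])
  have 2: "a[i := Suc (a ! i)] = take i a @ Suc (a ! i) # drop (Suc i) a"
    by (rule upd_conv_take_nth_drop[OF assms])
  have "(take i a @ (a ! i) # drop (Suc i) a, take i a @ Suc (a ! i) # drop (Suc i) a)
      \<in> lexord {(u, v). u < v}"
    by (rule lexord_append_leftI) (simp add: lexord_cons_cons)
  then show ?thesis unfolding list_less_def using 1 2 by metis
qed

context nonarch_local_field
begin

text \<open>
  The coercion in \<open>M_set\<close> reads \<open>map real a ! i\<close>, so its entries are those of \<open>a\<close> only within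
  the length of \<open>a\<close>.
\<close>

lemma M_set_iff:
  assumes "B \<in> carrier_mat n n" "transpose_mat B = B" "length a = n"
  shows "B \<in> M_set ord n a \<longleftrightarrow> half_form ord n (\<lambda>i. int (a ! i)) (\<lambda>i j. 2 * B $$ (i, j))"
proof -
  have sym: "B $$ (i, j) = B $$ (j, i)" if "i < n" "j < n" for i j
    using index_transpose_mat(1)[of j B i] assms that by simp
  show ?thesis
  proof
    assume M: "B \<in> M_set ord n a"
    have diag: "ereal (real (a ! i)) \<le> ord (B $$ (i, i))" if "i < n" for i
      using M that assms(3) by (simp add: M_set_def)
    have off: "ereal ((real (a ! i) + real (a ! j)) / 2) \<le> ord (2 * B $$ (i, j))" if "i < j" "j < n" for i j
      using M that assms(3) by (simp add: M_set_def)
    have entry: "ereal ((real (a ! i) + real (a ! j)) / 2) \<le> ord (2 * B $$ (i, j))" if "i < n" "j < n" for i j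
    proof (cases i j rule: linorder_cases)
      case less
      then show ?thesis using off that by simp
    next
      case equal
      then show ?thesis using order_trans[OF diag[OF that(1)] ord_half_le[of "2 * B $$ (i, i)", simplified]]
        by simp
    next
      case greater
      then show ?thesis using off[OF greater] that sym[OF that] by (simp add: add.commute)
    qed
    show "half_form ord n (\<lambda>i. int (a ! i)) (\<lambda>i j. 2 * B $$ (i, j))"
      unfolding half_form_def using diag entry sym by simp
  next
    assume H: "half_form ord n (\<lambda>i. int (a ! i)) (\<lambda>i j. 2 * B $$ (i, j))"
    have diag: "ereal (real (a ! i)) \<le> ord (B $$ (i, i))" if "i < n" for i
      using half_form_diag[OF H that] by simp
    have entry: "ereal ((real (a ! i) + real (a ! j)) / 2) \<le> ord (2 * B $$ (i, j))" if "i < n" "j < n" for i j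
      using half_form_entry[OF H that] by simp
    have "0 \<le> ord (B $$ (i, i))" if "i < n" for i
      by (rule order_trans[OF _ diag[OF that]]) simp
    moreover have "0 \<le> ord (2 * B $$ (i, j))" if "i < n" "j < n" for i j
      by (rule order_trans[OF _ entry[OF that]]) simp
    ultimately show "B \<in> M_set ord n a"
      unfolding M_set_def half_integral_def val_ring_def using assms diag entry by simp
  qed
qed

section \<open>Integral invertible matrices\<close>

lemma int_mat_mult:
  assumes "U \<in> int_mat ord n" "W \<in> int_mat ord n"
  shows "U * W \<in> int_mat ord n"
  using assms by (auto simp: int_mat_def val_ring_def scalar_prod_def intro!: ord_sum_ge ord_mult_ge0)

lemma GL_int_carrier: "U \<in> GL_int ord n \<Longrightarrow> U \<in> carrier_mat n n"
  by (simp add: GL_int_def int_mat_def)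

lemma GL_intI:
  assumes "U \<in> int_mat ord n" "V \<in> int_mat ord n" "U * V = 1\<^sub>m n"
  shows "U \<in> GL_int ord n"
proof -
  have c: "U \<in> carrier_mat n n" "V \<in> carrier_mat n n" using assms by (auto simp: int_mat_def)
  then have "V * U = 1\<^sub>m n" using mat_mult_left_right_inverse[OF c assms(3)] by simp
  then show ?thesis using assms c unfolding GL_int_def inverts_mat_def by auto
qed

lemma GL_int_mult:
  assumes "U \<in> GL_int ord n" "W \<in> GL_int ord n"
  shows "U * W \<in> GL_int ord n"
proof -
  obtain V where V: "V \<in> int_mat ord n" "U * V = 1\<^sub>m n"
    using assms(1) unfolding GL_int_def inverts_mat_def int_mat_def by auto
  obtain Y where Y: "Y \<in> int_mat ord n" "W * Y = 1\<^sub>m n"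
    using assms(2) unfolding GL_int_def inverts_mat_def int_mat_def by auto
  have U: "U \<in> int_mat ord n" and W: "W \<in> int_mat ord n" using assms by (auto simp: GL_int_def)
  have c: "U \<in> carrier_mat n n" "W \<in> carrier_mat n n" "V \<in> carrier_mat n n" "Y \<in> carrier_mat n n"
    using U W V Y by (auto simp: int_mat_def)
  have "U * W * (Y * V) = U * (W * Y) * V"
    using c by (simp add: assoc_mult_mat[of _ n n _ n _ n])
  also have "\<dots> = 1\<^sub>m n" using c V Y by simp
  finally show ?thesis using int_mat_mult U W V Y by (intro GL_intI[of _ _ "Y * V"])
qed

lemma one_GL_int: "1\<^sub>m n \<in> GL_int ord n"
proof -
  have "1\<^sub>m n \<in> int_mat ord n" by (auto simp: int_mat_def val_ring_def)
  then show ?thesis by (rule GL_intI[OF _ \<open>1\<^sub>m n \<in> int_mat ord n\<close>]) auto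
qed

lemma ord_det_ge: "U \<in> int_mat ord n \<Longrightarrow> 0 \<le> ord (det U)"
proof -
  assume U: "U \<in> int_mat ord n"
  then have "dt n (\<lambda>i j. U $$ (i, j)) = det U"
    by (auto simp: dt_def int_mat_def intro!: arg_cong[of _ _ det] eq_matI)
  moreover have "ereal (\<Sum>i<n. 0) \<le> ord (dt n (\<lambda>i j. U $$ (i, j)))"
    using U by (intro ord_dt_ge) (auto simp: int_mat_def val_ring_def zero_ereal_def)
  ultimately show ?thesis by (simp add: zero_ereal_def)
qed

lemma ord_det_GL_int: "U \<in> GL_int ord n \<Longrightarrow> ord (det U) = 0"
proof -
  assume "U \<in> GL_int ord n"
  then obtain V where U: "U \<in> int_mat ord n" and V: "V \<in> int_mat ord n" "U * V = 1\<^sub>m n"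
    unfolding GL_int_def inverts_mat_def int_mat_def by auto
  have "det U * det V = 1"
    using det_mult[of U n V] U V by (simp add: int_mat_def)
  then have "ord (det U) + ord (det V) = 0" by (metis ord_mult ord_1)
  then show ?thesis using ord_det_ge[OF U] ord_det_ge[OF V(1)]
    by (cases "ord (det U)"; cases "ord (det V)") auto
qed

text \<open>As \<open>z i = 1\<close>, negating the other entries of the replaced column inverts the
  substitution. The permutation reorders columns, and the rows of the inverse accordingly.\<close>

lemma col_subst_GL_int:
  assumes i: "i < n" and z: "z i = 1" "\<And>l. l < n \<Longrightarrow> 0 \<le> ord (z l)" and p: "p permutes {..<n}"
  shows "mat n n (\<lambda>(l, k). col_subst i z l (p k)) \<in> GL_int ord n"
proof (rule GL_intI)
  have lt: "p k < n" if "k < n" for k using permutes_in_image[OF p, of k] that by simp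
  let ?z = "\<lambda>l. if l = i then 1 else - z l"
  let ?W = "mat n n (\<lambda>(l, k). col_subst i z l (p k))"
  let ?V = "mat n n (\<lambda>(l, k). col_subst i ?z (p l) k)"
  show "?W \<in> int_mat ord n" "?V \<in> int_mat ord n"
    using z lt by (auto simp: int_mat_def val_ring_def col_subst_def)
  show "?W * ?V = 1\<^sub>m n"
  proof (rule eq_matI)
    fix l k assume "l < dim_row (1\<^sub>m n :: 'a mat)" "k < dim_col (1\<^sub>m n :: 'a mat)"
    then have lk: "l < n" "k < n" by auto
    have "(?W * ?V) $$ (l, k) = (\<Sum>j<n. col_subst i z l (p j) * col_subst i ?z (p j) k)"
      using lk by (simp add: scalar_prod_def atLeast0LessThan)
    also have "\<dots> = (\<Sum>j<n. col_subst i z l j * col_subst i ?z j k)"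
      using sum.permute[OF p, of "\<lambda>j. col_subst i z l j * col_subst i ?z j k"] by (simp add: o_def)
    also have "\<dots> = (if k = i then (\<Sum>j<n. col_subst i z l j * ?z j) else col_subst i z l k)"
      by (rule row_col_subst[OF lk(2)])
    also have "(\<Sum>j<n. col_subst i z l j * ?z j) = z l + (\<Sum>j\<in>{..<n} - {i}. col_subst i z l j * ?z j)"
      using i by (subst sum.remove[of _ i]) (auto simp: col_subst_def)
    also have "(\<Sum>j\<in>{..<n} - {i}. col_subst i z l j * ?z j) = (\<Sum>j\<in>{..<n} - {i}. if l = j then - z l else 0)"
      by (rule sum.cong) (auto simp: col_subst_def)
    also have "\<dots> = (if l = i then 0 else - z l)" using lk by simp
    finally show "(?W * ?V) $$ (l, k) = 1\<^sub>m n $$ (l, k)"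
      using lk z(1) by (auto simp: col_subst_def)
  qed auto
qed

text \<open>Sortedness enters twice. The vector \<open>z\<close> vanishes after \<open>i\<close>,
  and up to \<open>i\<close> the bound \<open>a l \<le> a i\<close> makes its coordinates integral.
  Raising entry \<open>i\<close> could spoil the order, so basis vector \<open>i\<close> is first
  swapped with the last one of equal weight, \<open>m\<close>.\<close>

lemma defective_improve:
  assumes B: "B \<in> carrier_mat n n" "transpose_mat B = B" and a: "length a = n" "sorted a"
    and M: "B \<in> M_set ord n a"
    and d: "defective ord n (\<lambda>i. int (a ! i)) (\<lambda>i j. 2 * B $$ (i, j))"
  shows "\<exists>W \<in> GL_int ord n. \<exists>a' \<in> S_set ord n (mat_transform B W). a < a'"
proof -
  let ?T = "\<lambda>i j. 2 * B $$ (i, j)" and ?a = "\<lambda>i. int (a ! i)"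
  have T: "half_form ord n ?a ?T" using M M_set_iff[OF B a(1)] by simp
  obtain i z where i: "i < n" and z: "z i = 1" "\<And>l. i < l \<Longrightarrow> z l = 0"
    "norm_ge ord n ?a (of_int (?a i) / 2) z" "ereal (of_int (?a i)) < ord (bil n ?T z z / 2)"
    "\<And>l. l < n \<Longrightarrow> ereal ((of_int (?a l) + of_int (?a i)) / 2) < ord (\<Sum>j<n. ?T l j * z j)"
    by (rule defective_normalized[OF T d]) (rule that)
  have zint: "0 \<le> ord (z l)" if "l < n" for l
  proof (cases "i < l")
    case False
    then have "a ! l \<le> a ! i" using sorted_nth_mono[OF a(2), of l i] i a(1) by simp
    then have "0 \<le> ereal (of_int (?a i) / 2 - of_int (?a l) / 2)" by simp
    also have "\<dots> \<le> ord (z l)" using z(3) that by (simp add: norm_ge_def)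
    finally show ?thesis .
  qed (use z in simp)
  define I where "I = {l. l < n \<and> a ! l = a ! i}"
  define m where "m = Max I"
  have I: "finite I" "i \<in> I" using i by (auto simp: I_def)
  have "m \<in> I" unfolding m_def using I by (intro Max_in) auto
  then have m: "m < n" "a ! m = a ! i" by (auto simp: I_def)
  have last: "a ! m < a ! l" if "m < l" "l < n" for l
  proof -
    have "l \<notin> I" using Max_ge[OF I(1), of l] that by (auto simp: m_def)
    then have "a ! l \<noteq> a ! m" using that m by (simp add: I_def)
    then show ?thesis using sorted_nth_mono[OF a(2), of m l] that a(1) by simp
  qed
  define a' where "a' = a[m := Suc (a ! m)]"
  have "sorted a'"
    unfolding sorted_iff_nth_mono
  proof (intro allI impI)
    fix j l assume jl: "j \<le> l" "l < length a'"
    then have "a ! j \<le> a ! l" using sorted_nth_mono[OF a(2), of j l] by (simp add: a'_def)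
    then show "a' ! j \<le> a' ! l"
      using jl last[of l] m(1) a(1) by (auto simp: a'_def nth_list_update)
  qed
  let ?p = "transpose i m"
  have p: "?p permutes {..<n}" using i m by (intro permutes_swap_id) auto
  have lt: "?p k < n" if "k < n" for k using permutes_in_image[OF p, of k] that by simp
  define W where "W = mat n n (\<lambda>(l, k). col_subst i z l (?p k))"
  have W: "W \<in> GL_int ord n" unfolding W_def by (rule col_subst_GL_int[where z = z]) (fact i z(1) zint p)+
  have Wc: "W \<in> carrier_mat n n" by (simp add: W_def)
  let ?R = "\<lambda>k l. bil n ?T (\<lambda>j. col_subst i z j k) (\<lambda>j. col_subst i z j l)"
  have "half_form ord n (\<lambda>l. if l = i then ?a l + 1 else ?a l) ?R"
    by (rule half_form_col_subst[OF T i z(4)]) (rule z(5))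
  from half_form_permute[OF p this]
  have R: "half_form ord n (\<lambda>l. if ?p l = i then ?a (?p l) + 1 else ?a (?p l)) (\<lambda>k l. ?R (?p k) (?p l))" .
  have wt: "(if ?p l = i then ?a (?p l) + 1 else ?a (?p l)) = int (a' ! l)" if "l < n" for l
    using that i m a(1) by (auto simp: a'_def transpose_def nth_list_update)
  have ent: "?R (?p k) (?p l) = 2 * mat_transform B W $$ (k, l)" if "k < n" "l < n" for k l
    unfolding mat_transform_index[OF B(1) Wc that]
    using that by (simp add: W_def bil_def sum_distrib_left mult_ac)
  have "half_form ord n (\<lambda>i. int (a' ! i)) (\<lambda>i j. 2 * mat_transform B W $$ (i, j))"
    using R wt ent unfolding half_form_def by simp
  then have "mat_transform B W \<in> M_set ord n a'"
    using M_set_iff[OF mat_transform_carrier[OF B(1) Wc] mat_transform_symmetric[OF B Wc], of a'] a(1)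
    by (simp add: a'_def)
  then have "a' \<in> S_set ord n (mat_transform B W)"
    using \<open>sorted a'\<close> a(1) by (simp add: S_set_def a'_def)
  moreover have "a < a'" unfolding a'_def using m(1) a(1) by (intro list_update_Suc_greater) simp
  ultimately show ?thesis using W by blast
qed

lemma disc_form_unit_square:
  assumes "ord u = 0" "disc_form ord (u\<^sup>2 * D) k"
  shows "disc_form ord D k"
proof -
  have u0: "u \<noteq> 0" using assms(1) by auto
  obtain y s w where y: "y \<noteq> 0" "u\<^sup>2 * D = y\<^sup>2 * (s\<^sup>2 - 4 * w)"
    and sw: "unit_disc ord s w \<and> ord y + ord y = ereal (of_int k) \<or>
      eisenstein ord s w \<and> ord y + ord y + 1 = ereal (of_int k)"
    using assms(2) unfolding disc_form_def by blast
  have "ord (y / u) = ord y" using ord_divide[of u 0 y] assms(1) by (simp add: zero_ereal_def)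
  moreover have "D = (y / u)\<^sup>2 * (s\<^sup>2 - 4 * w)" using y u0 by (simp add: field_simps power_divide)
  moreover have "y / u \<noteq> 0" using y u0 by simp
  ultimately show ?thesis using sw unfolding disc_form_def by metis
qed

lemma sum_GK_eq_Delta:
  assumes "B \<in> half_integral_nd ord n"
  shows "ereal (real (sum_list (GK ord n B))) = Delta_inv ord n B"
proof -
  have B: "B \<in> carrier_mat n n" "transpose_mat B = B" "det B \<noteq> 0" and Bh: "B \<in> half_integral ord n"
    using assms by (auto simp: half_integral_nd_def half_integral_def)
  define G where "G = (\<Union>U \<in> GL_int ord n. S_set ord n (mat_transform B U))"
  have form: "half_form ord n (\<lambda>i. int (a ! i)) (\<lambda>i j. 2 * mat_transform B U $$ (i, j))"
    if "U \<in> GL_int ord n" "a \<in> S_set ord n (mat_transform B U)" for U a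
  proof -
    have U: "U \<in> carrier_mat n n" by (rule GL_int_carrier[OF that(1)])
    show ?thesis
      using that(2) M_set_iff[OF mat_transform_carrier[OF B(1) U] mat_transform_symmetric[OF B(1,2) U], of a]
      by (simp add: S_set_def)
  qed
  have dtU: "dt n (\<lambda>i j. 2 * mat_transform B U $$ (i, j)) = (det U)\<^sup>2 * (2 ^ n * det B)"
    if "U \<in> GL_int ord n" for U
    using dt_double[OF mat_transform_carrier[OF B(1) GL_int_carrier[OF that]]]
      det_mat_transform[OF B(1) GL_int_carrier[OF that]] by simp
  obtain N :: int where N: "ord (2 ^ n * det B) = ereal (of_int N)"
    using ord_nonzeroE[of "2 ^ n * det B"] B(3) by auto
  \<comment> \<open>A base change in \<open>GL_int\<close> preserves the valuation of the
    determinant, which bounds the sum of every admissible sequence. So the greatest element in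
    \<open>GK\<close> exists and is a maximum.\<close>
  have "G \<subseteq> {a. set a \<subseteq> {..nat N} \<and> length a = n}"
  proof (intro subsetI CollectI)
    fix a assume "a \<in> G"
    then obtain U where U: "U \<in> GL_int ord n" "a \<in> S_set ord n (mat_transform B U)"
      unfolding G_def by blast
    have len: "length a = n" using U(2) by (simp add: S_set_def)
    have "ereal (\<Sum>i<n. of_int (int (a ! i))) \<le> ord (dt n (\<lambda>i j. 2 * mat_transform B U $$ (i, j)))"
      by (rule ord_dt_ge) (rule half_form_entry[OF form[OF U]])
    also have "\<dots> = ereal (of_int N)"
      unfolding dtU[OF U(1)] ord_mult ord_power2 ord_det_GL_int[OF U(1)] using N by (simp add: ord_mult)
    finally have "real_of_int (\<Sum>i<n. int (a ! i)) \<le> of_int N" by simp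
    then have "(\<Sum>i<n. int (a ! i)) \<le> N" by (simp only: of_int_le_iff)
    moreover have "int (a ! i) \<le> (\<Sum>i<n. int (a ! i))" if "i < n" for i
      using that by (intro member_le_sum) auto
    ultimately have "a ! i \<le> nat N" if "i < n" for i using that by fastforce
    then show "set a \<subseteq> {..nat N} \<and> length a = n" using len by (auto simp: in_set_conv_nth)
  qed
  then have fin: "finite G" by (rule finite_subset) (simp add: finite_lists_length_eq)
  have B1: "mat_transform B (1\<^sub>m n) = B" using B by (simp add: mat_transform_def)
  \<comment> \<open>For the zero sequence the bounds amount to half-integrality.\<close>
  have "replicate n 0 \<in> S_set ord n (mat_transform B (1\<^sub>m n))"
    using Bh unfolding B1 by (auto simp: S_set_def M_set_def half_integral_def val_ring_def zero_ereal_def)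
  then have ne: "G \<noteq> {}" unfolding G_def using one_GL_int by blast
  define a where "a = GK ord n B"
  have a: "a = Max G"
    unfolding a_def GK_def G_def[symmetric]
    by (rule Greatest_equality) (use fin ne in \<open>auto intro: Max_in Max_ge\<close>)
  have "a \<in> G" unfolding a using fin ne by (rule Max_in)
  then obtain U where U: "U \<in> GL_int ord n" "a \<in> S_set ord n (mat_transform B U)"
    unfolding G_def by blast
  have Uc: "U \<in> carrier_mat n n" by (rule GL_int_carrier[OF U(1)])
  let ?C = "mat_transform B U"
  let ?T = "\<lambda>i j. 2 * ?C $$ (i, j)"
  have C: "?C \<in> carrier_mat n n" "transpose_mat ?C = ?C"
    using mat_transform_carrier mat_transform_symmetric B Uc by blast+
  have nd: "\<not> defective ord n (\<lambda>i. int (a ! i)) ?T"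
  proof
    assume "defective ord n (\<lambda>i. int (a ! i)) ?T"
    then obtain W a' where W: "W \<in> GL_int ord n" "a' \<in> S_set ord n (mat_transform ?C W)" "a < a'"
      using defective_improve[OF C, of a] U(2) by (auto simp: S_set_def)
    have "mat_transform ?C W = mat_transform B (U * W)"
      using B(1) Uc GL_int_carrier[OF W(1)] by (rule mat_transform_mult)
    then have "a' \<in> G" unfolding G_def using W GL_int_mult[OF U(1) W(1)] by auto
    then have "a' \<le> a" unfolding a using fin by (intro Max_ge)
    then show False using W(3) by simp
  qed
  have k: "real (sum_list a) = of_int (\<Sum>i<n. int (a ! i))"
    using U(2) by (simp add: S_set_def sum_list_sum_nth atLeast0LessThan)
  have u: "ord (det U) = 0" by (rule ord_det_GL_int[OF U(1)])
  let ?D = "D_inv n B"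
  have D0: "?D \<noteq> 0" using B(3) by (simp add: D_inv_def)
  show ?thesis
  proof (cases "odd n")
    case True
    then obtain l where l: "n = 2 * l + 1" by (elim oddE)
    \<comment> \<open>\<open>2 ^ n / 2 = 4 ^ l\<close> is the normalizing factor of
      \<open>D_inv\<close> up to sign, and only the valuation counts in odd rank.\<close>
    have "dt n ?T / 2 = (det U)\<^sup>2 * (4 ^ l * det B)"
      unfolding dtU[OF U(1)] by (simp add: l power_mult)
    moreover have "?D = (-1) ^ l * (4 ^ l * det B)"
      by (simp add: D_inv_def l flip: mult.assoc power_mult_distrib)
    moreover have "ord ((-1) ^ l) = 0" by (cases "even l") (auto simp: ord_minus_1)
    ultimately have "ord ?D = ord (dt n ?T / 2)" by (simp add: ord_mult ord_power2 u)
    also have "\<dots> = ereal (of_int (\<Sum>i<n. int (a ! i)))"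
      by (rule nondefective_dt(1)[OF form[OF U] nd True])
    finally show ?thesis using True k by (simp add: Delta_inv_def a_def)
  next
    case False
    then obtain l where l: "n = 2 * l" by auto
    \<comment> \<open>In even rank the square class counts, so the sign must come out exactly;
      \<open>det U\<close> contributes only the square of a unit.\<close>
    have "(-1) ^ l * 2 ^ n = (-4 :: 'a) ^ l"
      by (simp add: l power_mult flip: power_mult_distrib)
    then have "(-1) ^ (n div 2) * dt n ?T = (det U)\<^sup>2 * ?D"
      unfolding dtU[OF U(1)] by (simp add: D_inv_def l)
    then have "disc_form ord ((det U)\<^sup>2 * ?D) (\<Sum>i<n. int (a ! i))"
      using nondefective_dt(2)[OF form[OF U] nd] False by simp
    then have "disc_form ord ?D (\<Sum>i<n. int (a ! i))" by (rule disc_form_unit_square[OF u])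
    from disc_form_invariant[OF D0 this]
    have "ord ?D - ereal (ord_ideal ord (disc_ideal ord ?D)) + 1
      - (if nonzero_square ?D \<or> unramified_quad ord ?D then 1 else 0) = ereal (real (sum_list a))"
      by (simp only: k)
    moreover have "ereal (of_int ((xi_inv ord n B)\<^sup>2))
        = (if nonzero_square ?D \<or> unramified_quad ord ?D then 1 else 0)"
      by (simp add: xi_inv_def one_ereal_def zero_ereal_def)
    ultimately show ?thesis using False by (simp only: Delta_inv_def a_def if_False)
  qed
qed

end

theorem theorem0p1:
  fixes ord :: "'a::field_char_0 \<Rightarrow> ereal" and \<pi> :: 'a and n :: nat and B :: "'a mat"
  assumes "nonarch_local_field ord \<pi>"
    and "B \<in> half_integral_nd ord n"
  shows "ereal (real (sum_list (GK ord n B))) = Delta_inv ord n B"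
  using assms by (rule nonarch_local_field.sum_GK_eq_Delta)

end
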